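(* Let $\lambda>0$. If $-\frac12\le t\le\frac12$, then $$\widehat{K}_\lambda(t)=\theta_1(t,i\lambda).$$ If $-1\le t\le1$, then $$\widehat{L}_\lambda(t)=(1-|t|)\,\theta_1(t,i\lambda)-(2\pi)^{-1}\lambda\,\mathrm{sgn}(t)\,\frac{\partial\theta_1}{\partial t}(t,i\lambda)$$ and $$\widehat{M}_\lambda(t)=(1-|t|)\,\theta_3(t,i\lambda)-(2\pi)^{-1}\lambda\,\mathrm{sgn}(t)\,\frac{\partial\theta_3}{\partial t}(t,i\lambda).$$
   Context: For $\lambda>0$, $G_\lambda(z)=e^{-\pi\lambda z^2}$, and $K_\lambda,L_\lambda,M_\lambda$ are the entire functions (removable singularities filled in) $$K_\lambda(z)=\frac{\cos\pi z}{\pi}\sum_{n\in\mathbb{Z}}(-1)^{n+1}\frac{G_\lambda(n+\frac12)}{z-n-\frac12},$$ $$L_\lambda(z)=\Bigl(\frac{\cos\pi z}{\pi}\Bigr)^2\Bigl\{\sum_{m\in\mathbb{Z}}\frac{G_\lambda(m+\frac12)}{(z-m-\frac12)^2}+\sum_{n\in\mathbb{Z}}\frac{G_\lambda'(n+\frac12)}{z-n-\frac12}\Bigr\},$$ $$M_\lambda(z)=\Bigl(\frac{\sin\pi z}{\pi}\Bigr)^2\Bigl\{\sum_{m\in\mathbb{Z}}\frac{G_\lambda(m)}{(z-m)^2}+\sum_{n\in\mathbb{Z}}\frac{G_\lambda'(n)}{z-n}\Bigr\}.$$ Their restrictions to $\mathbb{R}$ are integrable. With $e(z)=e^{2\pi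 i z}$, the Fourier transform is $\widehat{f}(t)=\int_{-\infty}^\infty f(x)e(-xt)\,dx$. For $\Im\tau>0$ and $q=e^{\pi i\tau}$ (and $q^s=e^{\pi i\tau s}$), $\theta_1(v,\tau)=\sum_{n\in\mathbb{Z}}q^{(n+\frac12)^2}e((n+\frac12)v)$ and $\theta_3(v,\tau)=\sum_{n\in\mathbb{Z}}q^{n^2}e(nv)$; $\partial\theta_j/\partial t$ is the derivative in the first variable. *)

theory Defs
  imports "HOL-Complex_Analysis.Complex_Analysis"
begin

definition e_fun :: "complex \<Rightarrow> complex" where
  "e_fun z = exp (2 * of_real pi * \<i> * z)"

definition gaussian :: "real \<Rightarrow> complex \<Rightarrow> complex" where
  "gaussian lam z = exp (- (of_real pi * of_real lam * z^2))"

text \<open>The series below are ill-defined at their poles (where division by zero yields junk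
  values); \<^const>\<open>remove_sings\<close> replaces these values by the limits, giving entire functions.\<close>

definition K_fun :: "real \<Rightarrow> complex \<Rightarrow> complex" where
  "K_fun lam = remove_sings (\<lambda>z.
     cos (of_real pi * z) / of_real pi *
     (\<Sum>\<^sub>\<infinity>n::int. (-1) powi (n + 1) * (gaussian lam (of_int n + 1/2) / (z - of_int n - 1/2))))"

definition L_fun :: "real \<Rightarrow> complex \<Rightarrow> complex" where
  "L_fun lam = remove_sings (\<lambda>z.
     (cos (of_real pi * z) / of_real pi)^2 *
     ((\<Sum>\<^sub>\<infinity>m::int. gaussian lam (of_int m + 1/2) / (z - of_int m - 1/2)^2) +
      (\<Sum>\<^sub>\<infinity>n::int. deriv (gaussian lam) (of_int n + 1/2) / (z - of_int n - 1/2))))"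

definition M_fun :: "real \<Rightarrow> complex \<Rightarrow> complex" where
  "M_fun lam = remove_sings (\<lambda>z.
     (sin (of_real pi * z) / of_real pi)^2 *
     ((\<Sum>\<^sub>\<infinity>m::int. gaussian lam (of_int m) / (z - of_int m)^2) +
      (\<Sum>\<^sub>\<infinity>n::int. deriv (gaussian lam) (of_int n) / (z - of_int n))))"

definition fourier_transform :: "(real \<Rightarrow> complex) \<Rightarrow> real \<Rightarrow> complex" where
  "fourier_transform f t = (LINT x|lborel. f x * e_fun (of_real (- (x * t))))"

text \<open>For the nome \<open>q = exp (\<pi> \<i> \<tau>)\<close> this is \<open>q\<^sup>s\<close>, with the branch fixed by \<open>\<tau>\<close>.\<close>

definition nome_pow :: "complex \<Rightarrow> complex \<Rightarrow> complex" where
  "nome_pow \<tau> s = exp (of_real pi * \<i> * \<tau> * s)"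

definition theta1 :: "complex \<Rightarrow> complex \<Rightarrow> complex" where
  "theta1 v \<tau> = (\<Sum>\<^sub>\<infinity>n::int. nome_pow \<tau> ((of_int n + 1/2)^2) * e_fun ((of_int n + 1/2) * v))"

definition theta3 :: "complex \<Rightarrow> complex \<Rightarrow> complex" where
  "theta3 v \<tau> = (\<Sum>\<^sub>\<infinity>n::int. nome_pow \<tau> ((of_int n)^2) * e_fun (of_int n * v))"

end

theory Submission
  imports Defs "HOL-Probability.Sinc_Integral" "HOL-Probability.Characteristic_Functions"
begin

text \<open>
  Off the interpolation nodes \<open>a n\<close>, each of the three functions is a combination of sampling series
  \<open>F x = (\<Sum>n. c n * \<kappa> (x - a n))\<close>, where the kernel \<open>\<kappa> u\<close> is the integral of \<open>m t * cis (2 \<pi> u t)\<close> for a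
  bounded spectrum \<open>m\<close> that vanishes outside \<open>[-1, 1]\<close>. For \<open>K\<close> the spectrum is the indicator of
  \<open>[-1/2, 1/2]\<close>. For \<open>L\<close> and \<open>M\<close> the values of the Gaussian come with the tent function \<open>1 - \<bar>t\<bar>\<close>, and
  its derivatives with a multiple of \<open>sgn t\<close> on \<open>[-1, 1]\<close> (the lemmas \<open>sinc_band_kernel\<close>,
  \<open>fejer_band_kernel\<close> and \<open>sign_band_kernel\<close>). The Gaussian coefficients are summable, so summation
  and integration commute: \<open>F\<close> is the inverse Fourier transform of \<open>m t * \<Theta> t\<close> with
  \<open>\<Theta> t = (\<Sum>n. c n * cis (- 2 \<pi> a n t))\<close>. If \<open>c n\<close> is the value of the Gaussian at \<open>a n\<close>, then \<open>\<Theta>\<close>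
  is the theta function itself by the symmetry of the nodes; if \<open>c n\<close> is its derivative, then
  \<open>\<Theta>\<close> is \<open>- \<i> \<lambda>\<close> times the derivative of the theta function. Hence the formulas are instances of
  Fourier inversion, \<open>fourier_inversion_at_continuity_point\<close>, and no Poisson summation is involved.

  Inversion requires \<open>F\<close> to be integrable and \<open>m * \<Theta>\<close> to be continuous at the point in question.
  For the tent function both are immediate. The other two spectra jump, and correspondingly their
  kernels only decay like \<open>1 / u\<close>. Both defects disappear for the same reason. Reflecting the nodes at
  the origin changes the sign of every term of \<open>(\<Sum>n. c n * (x - a n) * \<kappa> (x - a n))\<close>, so this sum
  vanishes and \<open>F\<close> decays quadratically (\<open>sampling_series_integrable_cancelling\<close>); and at each jump
  the reflection changes the sign of every term of \<open>\<Theta>\<close>, so that \<open>m * \<Theta>\<close> is continuous there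
  (\<open>trig_series_value_coeff_eq_0\<close> and \<open>trig_series_slope_coeff_eq_0\<close>).
\<close>

section \<open>Fourier inversion at a point of continuity\<close>

lemma borel_measurable_cis [measurable]: "cis \<in> borel_measurable borel"
  by (intro borel_measurable_continuous_onI continuous_intros)

text \<open>
  After the substitution \<open>x = k y\<close> this is the characteristic function of the standard normal
  distribution. The right-hand side is an approximate identity in \<open>w\<close> as \<open>k\<close> grows.
\<close>

lemma integral_gaussian_cis:
  fixes w k :: real
  assumes k: "k > 0"
  shows "(LINT x|lborel. cis (2 * pi * (x * w)) * of_real (exp (- (x / k)\<^sup>2 / 2))) =
           of_real (2 * pi * k * std_normal_density (2 * pi * k * w))"
proof -
  have "(LINT x|lborel. cis (2 * pi * (x * w)) * of_real (exp (- (x / k)\<^sup>2 / 2))) =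
      k *\<^sub>R (LINT y|lborel. cis (2 * pi * (k * y * w)) * of_real (exp (- y\<^sup>2 / 2)))"
    using k by (subst lborel_integral_real_affine[where c = k and t = 0]) auto
  also have "(LINT y|lborel. cis (2 * pi * (k * y * w)) * of_real (exp (- y\<^sup>2 / 2))) =
      (LINT y|lborel. of_real (sqrt (2 * pi)) *
         (std_normal_density y *\<^sub>R iexp (2 * pi * k * w * y)))"
    by (intro Bochner_Integration.integral_cong)
       (auto simp: std_normal_density_def cis_conv_exp scaleR_conv_of_real mult_ac)
  also have "\<dots> = of_real (sqrt (2 * pi)) *
      (LINT y|lborel. std_normal_density y *\<^sub>R iexp (2 * pi * k * w * y))"
    by (rule integral_mult_right_zero)
  also have "\<dots> = of_real (sqrt (2 * pi)) * char std_normal_distribution (2 * pi * k * w)"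
    by (simp add: char_def integral_density normal_density_nonneg)
  also have "char std_normal_distribution (2 * pi * k * w) =
      of_real (exp (- (2 * pi * k * w)\<^sup>2 / 2))"
    by (simp add: char_std_normal_distribution)
  also have "k *\<^sub>R (of_real (sqrt (2 * pi)) * of_real (exp (- (2 * pi * k * w)\<^sup>2 / 2))) =
      (of_real (2 * pi * k * std_normal_density (2 * pi * k * w)) :: complex)"
  proof -
    have "k * sqrt (2 * pi) = 2 * pi * k / sqrt (2 * pi)"
      by (simp add: field_simps)
    hence "k * (sqrt (2 * pi) * exp (- (2 * pi * k * w)\<^sup>2 / 2)) =
        2 * pi * k * std_normal_density (2 * pi * k * w)"
      unfolding mult.assoc[symmetric] by (simp add: std_normal_density_def)
    thus ?thesis
      unfolding scaleR_conv_of_real of_real_mult[symmetric] by (rule arg_cong)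
  qed
  finally show ?thesis .
qed

text \<open>
  Weighting \<open>F\<close> by a wide Gaussian makes the double integral over \<open>x\<close> and \<open>t\<close> absolutely
  convergent, so Fubini applies; the inner integral over \<open>x\<close> is then the approximate identity of
  the preceding lemma, and the weighted Fourier integral becomes a Gaussian average of \<open>\<phi>\<close> around
  \<open>s\<close> at scale \<open>1 / k\<close>.
\<close>

lemma integral_gaussian_weight:
  fixes \<phi> F :: "real \<Rightarrow> complex"
  assumes \<phi>: "integrable lborel \<phi>"
    and F: "\<And>x. F x = (LINT t|lborel. \<phi> t * cis (2 * pi * (x * t)))"
    and k: "k > 0"
  shows "(LINT x|lborel. F x * cis (- (2 * pi * (x * s))) * of_real (exp (- (x / k)\<^sup>2 / 2))) =
         (LINT r|lborel. of_real (std_normal_density r) * \<phi> (s + r / (2 * pi * k)))"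
proof -
  define g where "g x = exp (- (x / k)\<^sup>2 / 2)" for x :: real
  define h where "h t x = \<phi> t * (cis (2 * pi * (x * (t - s))) * of_real (g x))" for t x
  have [measurable]: "\<phi> \<in> borel_measurable lborel"
    using \<phi> by auto
  have g_int: "integrable lborel g"
  proof -
    have "integrable lborel (\<lambda>x. sqrt (2 * pi) * std_normal_density (0 + (1 / k) * x))"
      using k by (intro integrable_mult_right lborel_integrable_real_affine integrable_normal_density) auto
    thus ?thesis
      by (simp add: g_def[abs_def] std_normal_density_def)
  qed
  have [measurable]: "g \<in> borel_measurable lborel"
    using g_int by auto
  have norm_h: "norm (h t x) = norm (\<phi> t) * g x" for t x
    by (simp add: h_def norm_mult g_def)
  have h_int: "integrable (lborel \<Otimes>\<^sub>M lborel) (case_prod h)"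
  proof (rule lborel_pair.Fubini_integrable)
    show "case_prod h \<in> borel_measurable (lborel \<Otimes>\<^sub>M lborel)"
      unfolding h_def by measurable
    show "integrable lborel (\<lambda>t. LINT x|lborel. norm (case_prod h (t, x)))"
      using \<phi> by (simp add: norm_h)
    show "AE t in lborel. integrable lborel (\<lambda>x. case_prod h (t, x))"
    proof (intro always_eventually allI)
      fix t
      show "integrable lborel (\<lambda>x. case_prod h (t, x))"
      proof (rule Bochner_Integration.integrable_bound)
        show "integrable lborel (\<lambda>x. norm (\<phi> t) * g x)"
          using g_int by simp
        show "AE x in lborel. norm (case_prod h (t, x)) \<le> norm (norm (\<phi> t) * g x)"
          by (simp add: norm_h g_def)
      qed (simp add: h_def)
    qed
  qed
  have "(LINT x|lborel. F x * cis (- (2 * pi * (x * s))) * of_real (g x)) =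
        (LINT x|lborel. (LINT t|lborel. h t x))"
  proof (intro Bochner_Integration.integral_cong refl)
    fix x
    have "h t x = \<phi> t * cis (2 * pi * (x * t)) * (cis (- (2 * pi * (x * s))) * of_real (g x))" for t
    proof -
      have "cis (2 * pi * (x * (t - s))) = cis (2 * pi * (x * t)) * cis (- (2 * pi * (x * s)))"
        by (simp add: cis_mult algebra_simps)
      thus ?thesis by (simp add: h_def)
    qed
    hence "(LINT t|lborel. h t x) =
          (LINT t|lborel. \<phi> t * cis (2 * pi * (x * t)) * (cis (- (2 * pi * (x * s))) * of_real (g x)))"
      by simp
    also have "\<dots> = F x * (cis (- (2 * pi * (x * s))) * of_real (g x))"
      unfolding F by (rule integral_mult_left_zero)
    finally show "F x * cis (- (2 * pi * (x * s))) * of_real (g x) = (LINT t|lborel. h t x)"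
      by (simp add: mult_ac)
  qed
  also have "\<dots> = (LINT t|lborel. (LINT x|lborel. h t x))"
    by (rule lborel_pair.Fubini_integral[OF h_int])
  also have "\<dots> = (LINT t|lborel. \<phi> t * of_real (2 * pi * k * std_normal_density (2 * pi * k * (t - s))))"
    unfolding h_def g_def using integral_gaussian_cis[OF k] by simp
  also have "\<dots> = (1 / (2 * pi * k)) *\<^sub>R
      (LINT r|lborel. \<phi> (s + (1 / (2 * pi * k)) * r) *
         of_real (2 * pi * k * std_normal_density r))"
    using k by (subst lborel_integral_real_affine[where c = "1 / (2 * pi * k)" and t = s]) auto
  also have "\<dots> = (LINT r|lborel. (1 / (2 * pi * k)) *\<^sub>R (\<phi> (s + (1 / (2 * pi * k)) * r) *
         of_real (2 * pi * k * std_normal_density r)))"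
    by simp
  also have "\<dots> = (LINT r|lborel. of_real (std_normal_density r) * \<phi> (s + r / (2 * pi * k)))"
    using k by (intro Bochner_Integration.integral_cong)
               (auto simp: scaleR_conv_of_real field_simps)
  finally show ?thesis
    by (simp add: g_def)
qed

text \<open>
  As the weight widens, dominated convergence applies on both sides of the preceding identity: on
  the left \<open>F\<close> itself dominates, on the right the averages of the bounded function \<open>\<phi>\<close> concentrate
  at \<open>s\<close>, where continuity identifies the limit as \<open>\<phi> s\<close>.
\<close>

lemma fourier_inversion_at_continuity_point:
  fixes \<phi> F :: "real \<Rightarrow> complex"
  assumes \<phi>: "integrable lborel \<phi>" and bound: "\<And>t. norm (\<phi> t) \<le> B"
    and cont: "isCont \<phi> s"
    and F: "\<And>x. F x = (LINT t|lborel. \<phi> t * cis (2 * pi * (x * t)))"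
    and F_int: "integrable lborel F"
  shows "(LINT x|lborel. F x * cis (- (2 * pi * (x * s)))) = \<phi> s"
proof (rule LIMSEQ_unique)
  define k where "k j = real (Suc j)" for j
  have k_pos: "k j > 0" for j
    by (simp add: k_def)
  have k_lim: "(\<lambda>j. c / k j) \<longlonglongrightarrow> 0" for c
    unfolding k_def by (rule LIMSEQ_Suc) (rule lim_const_over_n)
  have [measurable]: "\<phi> \<in> borel_measurable lborel" "F \<in> borel_measurable lborel"
    using \<phi> F_int by auto
  let ?I = "\<lambda>j. LINT x|lborel. F x * cis (- (2 * pi * (x * s))) * of_real (exp (- (x / k j)\<^sup>2 / 2))"
  show "?I \<longlonglongrightarrow> (LINT x|lborel. F x * cis (- (2 * pi * (x * s))))"
  proof (rule integral_dominated_convergence)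
    show "integrable lborel (\<lambda>x. norm (F x))"
      using F_int by simp
    show "AE x in lborel. (\<lambda>j. F x * cis (- (2 * pi * (x * s))) *
            of_real (exp (- (x / k j)\<^sup>2 / 2))) \<longlonglongrightarrow> F x * cis (- (2 * pi * (x * s)))"
    proof (intro always_eventually allI)
      fix x
      have "(\<lambda>j. F x * cis (- (2 * pi * (x * s))) * of_real (exp (- (x / k j)\<^sup>2 / 2)))
              \<longlonglongrightarrow> F x * cis (- (2 * pi * (x * s))) * of_real (exp (- 0\<^sup>2 / 2))"
        by (intro tendsto_intros k_lim) auto
      thus "(\<lambda>j. F x * cis (- (2 * pi * (x * s))) *
            of_real (exp (- (x / k j)\<^sup>2 / 2))) \<longlonglongrightarrow> F x * cis (- (2 * pi * (x * s)))"
        by simp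
    qed
    show "AE x in lborel. norm (F x * cis (- (2 * pi * (x * s))) *
            of_real (exp (- (x / k j)\<^sup>2 / 2))) \<le> norm (F x)" for j
      by (intro always_eventually allI) (auto simp: norm_mult intro!: mult_left_le)
  qed measurable
  have "(\<lambda>j. LINT r|lborel. of_real (std_normal_density r) * \<phi> (s + r / (2 * pi * k j)))
          \<longlonglongrightarrow> (LINT r|lborel. of_real (std_normal_density r) * \<phi> s)"
  proof (rule integral_dominated_convergence)
    show "integrable lborel (\<lambda>r. std_normal_density r * B)"
      by simp
    show "AE r in lborel. (\<lambda>j. of_real (std_normal_density r) * \<phi> (s + r / (2 * pi * k j)))
            \<longlonglongrightarrow> of_real (std_normal_density r) * \<phi> s"
    proof (intro always_eventually allI tendsto_mult_left)
      fix r
      have "(\<lambda>j. s + (r / (2 * pi)) / k j) \<longlonglongrightarrow> s + 0"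
        by (intro tendsto_intros k_lim)
      hence "(\<lambda>j. s + r / (2 * pi * k j)) \<longlonglongrightarrow> s"
        by simp
      thus "(\<lambda>j. \<phi> (s + r / (2 * pi * k j))) \<longlonglongrightarrow> \<phi> s"
        by (rule isCont_tendsto_compose[OF cont])
    qed
    show "AE r in lborel. norm (of_real (std_normal_density r) * \<phi> (s + r / (2 * pi * k j)))
            \<le> std_normal_density r * B" for j
      using bound by (intro always_eventually allI) (auto simp: norm_mult intro!: mult_left_mono)
  qed measurable
  also have "(LINT r|lborel. of_real (std_normal_density r) * \<phi> s) = \<phi> s"
  proof -
    have "(LINT r|lborel. complex_of_real (std_normal_density r)) = of_real 1"
      using integral_normal_density[of 1 0] by (simp only: integral_complex_of_real)
    thus ?thesis by simp
  qed
  also have "(\<lambda>j. LINT r|lborel. of_real (std_normal_density r) * \<phi> (s + r / (2 * pi * k j))) = ?I"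
    using integral_gaussian_weight[OF \<phi> F k_pos] by (intro ext) simp
  finally show "?I \<longlonglongrightarrow> \<phi> s" .
qed

section \<open>Sampling series with summable coefficients\<close>

definition band_kernel :: "(real \<Rightarrow> complex) \<Rightarrow> real \<Rightarrow> complex" where
  "band_kernel m u = (LINT t|lborel. m t * cis (2 * pi * (u * t)))"

text \<open>
  The minus sign makes this the factor that the translates \<open>\<kappa> (x - a n)\<close> of a kernel contribute
  on the Fourier side.
\<close>

definition trig_series :: "(int \<Rightarrow> complex) \<Rightarrow> (int \<Rightarrow> real) \<Rightarrow> real \<Rightarrow> complex" where
  "trig_series c a t = (\<Sum>\<^sub>\<infinity>n. c n * cis (- (2 * pi * (a n * t))))"

lemma summable_on_norm_comparison:
  fixes f :: "'a \<Rightarrow> 'b :: banach"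
  assumes "g summable_on A" and "\<And>x. x \<in> A \<Longrightarrow> norm (f x) \<le> g x"
  shows "f summable_on A"
  using Infinite_Sum.abs_summable_on_comparison_test'[OF assms] by (rule abs_summable_summable)

text \<open>
  Integrals are exchanged below with series over the integers. The enumeration \<^const>\<open>int_decode\<close>
  turns these into series over the natural numbers, to which dominated convergence applies.
\<close>

lemma infsum_int_eq_suminf:
  fixes f :: "int \<Rightarrow> 'a :: banach"
  assumes "(\<lambda>n. norm (f n)) summable_on UNIV"
  shows "infsum f UNIV = (\<Sum>i. f (int_decode i))"
proof -
  have "f summable_on UNIV"
    using assms by (rule abs_summable_summable)
  hence "(\<lambda>i. f (int_decode i)) summable_on UNIV"
    by (subst summable_on_reindex_bij_betw[OF bij_int_decode])
  hence "(\<lambda>i. f (int_decode i)) sums (\<Sum>\<^sub>\<infinity>i. f (int_decode i))"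
    by (intro has_sum_imp_sums has_sum_infsum)
  thus ?thesis
    by (simp add: sums_iff infsum_reindex_bij_betw[OF bij_int_decode])
qed

lemma integral_infsum_int:
  fixes f :: "int \<Rightarrow> 'a \<Rightarrow> 'b :: {banach, second_countable_topology}"
  assumes int: "\<And>n. integrable M (f n)"
    and bound: "\<And>n x. norm (f n x) \<le> b n * g x"
    and b: "b summable_on UNIV" and b_nonneg: "\<And>n. b n \<ge> 0"
    and g: "integrable M g" and g_nonneg: "\<And>x. g x \<ge> 0"
  shows "(LINT x|M. (\<Sum>\<^sub>\<infinity>n. f n x)) = (\<Sum>\<^sub>\<infinity>n. LINT x|M. f n x)"
proof -
  have b_nat: "summable (\<lambda>i. b (int_decode i))"
  proof (rule summable_on_imp_summable)
    show "(\<lambda>i. b (int_decode i)) summable_on UNIV"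
      using b by (subst summable_on_reindex_bij_betw[OF bij_int_decode])
  qed
  have abs_sum: "(\<lambda>n. norm (f n x)) summable_on UNIV" for x
  proof (rule summable_on_comparison_test)
    show "(\<lambda>n. b n * g x) summable_on UNIV"
      using b by (rule summable_on_cmult_left)
  qed (use bound in auto)
  have int_le: "(LINT x|M. norm (f n x)) \<le> b n * (LINT x|M. g x)" for n
  proof -
    have "(LINT x|M. norm (f n x)) \<le> (LINT x|M. b n * g x)"
      using int g bound by (intro integral_mono) auto
    thus ?thesis by simp
  qed
  have norm_le: "norm (LINT x|M. f n x) \<le> b n * (LINT x|M. g x)" for n
    using integral_norm_bound[of M "f n"] int_le[of n] by linarith
  have abs_sum_int: "(\<lambda>n. norm (LINT x|M. f n x)) summable_on UNIV"
  proof (rule summable_on_comparison_test)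
    show "(\<lambda>n. b n * (LINT x|M. g x)) summable_on UNIV"
      using b by (rule summable_on_cmult_left)
  qed (use norm_le in auto)
  have "(LINT x|M. (\<Sum>\<^sub>\<infinity>n. f n x)) = (LINT x|M. (\<Sum>i. f (int_decode i) x))"
    by (simp add: infsum_int_eq_suminf[OF abs_sum])
  also have "\<dots> = (\<Sum>i. LINT x|M. f (int_decode i) x)"
  proof (rule integral_suminf)
    show "AE x in M. summable (\<lambda>i. norm (f (int_decode i) x))"
    proof (intro always_eventually allI)
      fix x
      show "summable (\<lambda>i. norm (f (int_decode i) x))"
        by (rule summable_comparison_test'[OF summable_mult2[OF b_nat, of "g x"], of 0])
           (use bound in auto)
    qed
    show "summable (\<lambda>i. LINT x|M. norm (f (int_decode i) x))"
      by (rule summable_comparison_test'[OF summable_mult2[OF b_nat, of "LINT x|M. g x"], of 0])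
         (use int_le in auto)
  qed (rule int)
  also have "\<dots> = (\<Sum>\<^sub>\<infinity>n. LINT x|M. f n x)"
    by (rule infsum_int_eq_suminf[OF abs_sum_int, symmetric])
  finally show ?thesis .
qed

lemma norm_band_kernel_le:
  assumes m: "integrable lborel m"
  shows "norm (band_kernel m u) \<le> (LINT t|lborel. norm (m t))"
proof -
  have "norm (band_kernel m u) \<le> (LINT t|lborel. norm (m t * cis (2 * pi * (u * t))))"
    unfolding band_kernel_def by (rule integral_norm_bound)
  thus ?thesis by (simp add: norm_mult)
qed

context
  fixes c :: "int \<Rightarrow> complex" and a :: "int \<Rightarrow> real"
  assumes c: "(\<lambda>n. norm (c n)) summable_on UNIV"
begin

lemma continuous_trig_series: "isCont (trig_series c a) t"
proof -
  have "uniform_limit UNIV (\<lambda>X t. \<Sum>n\<in>X. c n * cis (- (2 * pi * (a n * t))))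
          (\<lambda>t. \<Sum>\<^sub>\<infinity>n. c n * cis (- (2 * pi * (a n * t)))) (finite_subsets_at_top UNIV)"
    by (rule Weierstrass_m_test_general[OF _ c]) (auto simp: norm_mult)
  hence "continuous_on UNIV (trig_series c a)"
    unfolding trig_series_def[abs_def]
    by (rule uniform_limit_theorem[rotated]) (auto intro!: always_eventually continuous_intros)
  thus ?thesis
    by (simp add: continuous_on_eq_continuous_at)
qed

lemma norm_trig_series_le: "norm (trig_series c a t) \<le> (\<Sum>\<^sub>\<infinity>n. norm (c n))"
  using norm_infsum_bound[of "\<lambda>n. c n * cis (- (2 * pi * (a n * t)))" UNIV] c
  by (simp add: trig_series_def norm_mult)

lemma borel_measurable_trig_series [measurable]: "trig_series c a \<in> borel_measurable borel"
  using continuous_trig_series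
  by (intro borel_measurable_continuous_onI continuous_at_imp_continuous_on) auto

context
  fixes m :: "real \<Rightarrow> complex"
  assumes m: "integrable lborel m"
begin

lemma integrable_mult_trig_series: "integrable lborel (\<lambda>t. m t * trig_series c a t)"
proof (rule Bochner_Integration.integrable_bound)
  show "integrable lborel (\<lambda>t. norm (m t) * (\<Sum>\<^sub>\<infinity>n. norm (c n)))"
    using m by simp
  have [measurable]: "m \<in> borel_measurable lborel"
    using m by auto
  show "(\<lambda>t. m t * trig_series c a t) \<in> borel_measurable lborel"
    by measurable
  show "AE t in lborel. norm (m t * trig_series c a t) \<le> norm (norm (m t) * (\<Sum>\<^sub>\<infinity>n. norm (c n)))"
    using norm_trig_series_le by (auto simp: norm_mult infsum_nonneg intro!: mult_left_mono)
qed

text \<open>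
  Each translate \<open>\<kappa> (x - a n)\<close> has the spectrum \<open>m t\<close> modulated by \<open>cis (- 2 \<pi> a n t)\<close>. Since
  the coefficients are summable, the sum may be taken inside the integral, so the sampling series has
  the spectrum \<open>m\<close> times the trigonometric series.
\<close>

lemma sampling_series_eq_integral:
  "(\<Sum>\<^sub>\<infinity>n. c n * band_kernel m (x - a n)) =
     (LINT t|lborel. m t * trig_series c a t * cis (2 * pi * (x * t)))"
proof -
  have [measurable]: "m \<in> borel_measurable lborel"
    using m by auto
  have "(LINT t|lborel. m t * trig_series c a t * cis (2 * pi * (x * t))) =
        (LINT t|lborel. (\<Sum>\<^sub>\<infinity>n. c n * (m t * cis (2 * pi * ((x - a n) * t)))))"
  proof (intro Bochner_Integration.integral_cong refl)
    fix t
    have "m t * trig_series c a t * cis (2 * pi * (x * t)) =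
          (\<Sum>\<^sub>\<infinity>n. (m t * cis (2 * pi * (x * t))) * (c n * cis (- (2 * pi * (a n * t)))))"
      unfolding trig_series_def by (subst infsum_cmult_right') (simp add: mult_ac)
    also have "\<dots> = (\<Sum>\<^sub>\<infinity>n. c n * (m t * cis (2 * pi * ((x - a n) * t))))"
    proof (rule infsum_cong)
      fix n
      have "cis (2 * pi * ((x - a n) * t)) = cis (2 * pi * (x * t)) * cis (- (2 * pi * (a n * t)))"
        by (simp add: cis_mult algebra_simps)
      thus "(m t * cis (2 * pi * (x * t))) * (c n * cis (- (2 * pi * (a n * t)))) =
            c n * (m t * cis (2 * pi * ((x - a n) * t)))"
        by simp
    qed
    finally show "m t * trig_series c a t * cis (2 * pi * (x * t)) =
                    (\<Sum>\<^sub>\<infinity>n. c n * (m t * cis (2 * pi * ((x - a n) * t))))" .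
  qed
  also have "\<dots> = (\<Sum>\<^sub>\<infinity>n. LINT t|lborel. c n * (m t * cis (2 * pi * ((x - a n) * t))))"
  proof (rule integral_infsum_int[where b = "\<lambda>n. norm (c n)" and g = "\<lambda>t. norm (m t)"])
    fix n
    have "integrable lborel (\<lambda>t. m t * cis (2 * pi * ((x - a n) * t)))"
      by (rule Bochner_Integration.integrable_bound[OF m]) (auto simp: norm_mult)
    thus "integrable lborel (\<lambda>t. c n * (m t * cis (2 * pi * ((x - a n) * t))))"
      by simp
  qed (use c m in \<open>auto simp: norm_mult\<close>)
  finally show ?thesis
    by (simp add: band_kernel_def)
qed

lemma borel_measurable_sampling_series:
  "(\<lambda>x. \<Sum>\<^sub>\<infinity>n. c n * band_kernel m (x - a n)) \<in> borel_measurable lborel"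
proof -
  have [measurable]: "m \<in> borel_measurable lborel"
    using m by auto
  show ?thesis
    unfolding sampling_series_eq_integral by measurable
qed

end
end

section \<open>Integrability of sampling series\<close>

lemma integrable_quadratic_decay:
  fixes f :: "real \<Rightarrow> complex"
  assumes "f \<in> borel_measurable lborel" and "\<And>x. norm (f x) * (1 + x\<^sup>2) \<le> D"
  shows "integrable lborel f"
proof (rule Bochner_Integration.integrable_bound)
  have "integrable lborel (\<lambda>x::real. inverse (1 + x\<^sup>2))"
    using integrable_inverse_1_plus_square by (simp add: set_integrable_def)
  thus "integrable lborel (\<lambda>x::real. D * inverse (1 + x\<^sup>2))"
    by simp
  show "AE x in lborel. norm (f x) \<le> norm (D * inverse (1 + x\<^sup>2))"
  proof (intro always_eventually allI)
    fix x :: real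
    have pos: "1 + x\<^sup>2 > 0" by (smt (verit) zero_le_power2)
    have "norm (f x) \<le> D * inverse (1 + x\<^sup>2)"
      using assms(2)[of x] pos by (simp add: field_simps)
    thus "norm (f x) \<le> norm (D * inverse (1 + x\<^sup>2))" by simp
  qed
qed fact

lemma coeff_abs_summable:
  fixes c :: "int \<Rightarrow> complex" and a :: "int \<Rightarrow> real"
  assumes "(\<lambda>n. norm (c n) * (1 + (a n)\<^sup>2)) summable_on UNIV"
  shows "(\<lambda>n. norm (c n)) summable_on UNIV"
  by (rule summable_on_comparison_test[OF assms]) (auto simp: mult_left_le distrib_left)

context
  fixes c :: "int \<Rightarrow> complex" and a :: "int \<Rightarrow> real" and m :: "real \<Rightarrow> complex"
  assumes weight: "(\<lambda>n. norm (c n) * (1 + (a n)\<^sup>2)) summable_on UNIV"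
    and m: "integrable lborel m"
begin

text \<open>
  For a kernel of quadratic decay, \<open>1 + x\<^sup>2 \<le> 2 (1 + a\<^sup>2) (1 + (x - a)\<^sup>2)\<close> lets each translate inherit
  that decay at the price of a factor that the weighted coefficients absorb.
\<close>

lemma sampling_series_integrable_quadratic_kernel:
  assumes decay: "\<And>u. norm (band_kernel m u) * (1 + u\<^sup>2) \<le> C"
  shows "integrable lborel (\<lambda>x. \<Sum>\<^sub>\<infinity>n. c n * band_kernel m (x - a n))"
proof (rule integrable_quadratic_decay)
  show "(\<lambda>x. \<Sum>\<^sub>\<infinity>n. c n * band_kernel m (x - a n)) \<in> borel_measurable lborel"
    by (rule borel_measurable_sampling_series[OF coeff_abs_summable[OF weight] m])
  fix x
  have "norm (\<Sum>\<^sub>\<infinity>n. of_real (1 + x\<^sup>2) * (c n * band_kernel m (x - a n)))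
          \<le> (\<Sum>\<^sub>\<infinity>n. norm (c n) * (1 + (a n)\<^sup>2) * (2 * C))"
  proof (rule norm_infsum_le)
    have le: "norm (of_real (1 + x\<^sup>2) * (c n * band_kernel m (x - a n)))
             \<le> norm (c n) * (1 + (a n)\<^sup>2) * (2 * C)" for n
    proof -
      \<comment> \<open>With \<open>u = x - a n\<close>, the difference of the two sides of the next inequality is exactly this.\<close>
      have "0 \<le> (2 * a n - x)\<^sup>2 + 2 * (a n * (x - a n))\<^sup>2 + 1" by simp
      hence "1 + x\<^sup>2 \<le> 2 * (1 + (a n)\<^sup>2) * (1 + (x - a n)\<^sup>2)"
        by (simp add: power2_eq_square algebra_simps)
      hence "norm (c n) * norm (band_kernel m (x - a n)) * (1 + x\<^sup>2)
            \<le> norm (c n) * norm (band_kernel m (x - a n)) * (2 * (1 + (a n)\<^sup>2) * (1 + (x - a n)\<^sup>2))"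
        by (intro mult_left_mono) auto
      also have "\<dots> = norm (c n) * (2 * (1 + (a n)\<^sup>2)) * (norm (band_kernel m (x - a n)) * (1 + (x - a n)\<^sup>2))"
        by simp
      also have "\<dots> \<le> norm (c n) * (2 * (1 + (a n)\<^sup>2)) * C"
        by (intro mult_left_mono decay) auto
      finally show ?thesis
        unfolding norm_mult norm_of_real by (simp add: mult_ac)
    qed
    show "((\<lambda>n. of_real (1 + x\<^sup>2) * (c n * band_kernel m (x - a n))) has_sum
            (\<Sum>\<^sub>\<infinity>n. of_real (1 + x\<^sup>2) * (c n * band_kernel m (x - a n)))) UNIV"
      by (intro has_sum_infsum summable_on_norm_comparison[OF summable_on_cmult_left[OF weight] le])
    show "((\<lambda>n. norm (c n) * (1 + (a n)\<^sup>2) * (2 * C)) has_sum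
            (\<Sum>\<^sub>\<infinity>n. norm (c n) * (1 + (a n)\<^sup>2) * (2 * C))) UNIV"
      by (intro has_sum_infsum summable_on_cmult_left weight)
    show "norm (of_real (1 + x\<^sup>2) * (c n * band_kernel m (x - a n)))
             \<le> norm (c n) * (1 + (a n)\<^sup>2) * (2 * C)" for n
      by (rule le)
  qed
  thus "norm (\<Sum>\<^sub>\<infinity>n. c n * band_kernel m (x - a n)) * (1 + x\<^sup>2)
          \<le> (\<Sum>\<^sub>\<infinity>n. norm (c n) * (1 + (a n)\<^sup>2) * (2 * C))"
    unfolding infsum_cmult_right' norm_mult norm_of_real by (simp add: mult.commute)
qed

text \<open>
  Kernels that only decay like \<open>1 / u\<close> need cancellation. Write \<open>p n = (x - a n) \<kappa> (x - a n)\<close>.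
  From \<open>x\<^sup>2 - (a n)\<^sup>2 = (x - a n) (x + a n)\<close> one obtains
  \<open>(1 + x\<^sup>2) \<kappa> (x - a n) = (1 + (a n)\<^sup>2) \<kappa> (x - a n) + a n p n + x p n\<close>,
  and the only part that grows with \<open>x\<close> sums to zero by hypothesis. The remaining two parts are
  bounded after summation against the weighted coefficients.
\<close>

lemma sampling_series_integrable_cancelling:
  assumes decay: "\<And>u. norm (u * band_kernel m u) \<le> C"
    and cancel: "\<And>x. (\<Sum>\<^sub>\<infinity>n. c n * ((x - a n) * band_kernel m (x - a n))) = 0"
  shows "integrable lborel (\<lambda>x. \<Sum>\<^sub>\<infinity>n. c n * band_kernel m (x - a n))"
proof (rule integrable_quadratic_decay)
  show "(\<lambda>x. \<Sum>\<^sub>\<infinity>n. c n * band_kernel m (x - a n)) \<in> borel_measurable lborel"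
    by (rule borel_measurable_sampling_series[OF coeff_abs_summable[OF weight] m])
  fix x
  define L where "L = (LINT t|lborel. norm (m t))"
  define \<kappa> where "\<kappa> n = band_kernel m (x - a n)" for n
  define p where "p n = (x - a n) * \<kappa> n" for n
  have \<kappa>_le: "norm (\<kappa> n) \<le> L" for n
    unfolding \<kappa>_def L_def by (rule norm_band_kernel_le[OF m])
  have p_le: "norm (p n) \<le> C" for n
    unfolding p_def \<kappa>_def using decay[of "x - a n"] by simp
  have one_le: "1 \<le> 1 + (a n)\<^sup>2" "\<bar>a n\<bar> \<le> 1 + (a n)\<^sup>2" for n
    using sum_squares_bound[of 1 "\<bar>a n\<bar>"] by auto
  have weighted_le: "norm (c n * z) \<le> norm (c n) * (1 + (a n)\<^sup>2) * E" if "norm z \<le> E" for n z E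
  proof -
    have "1 * norm z \<le> (1 + (a n)\<^sup>2) * E"
      using one_le(1)[of n] that by (intro mult_mono) auto
    from mult_left_mono[OF this norm_ge_zero[of "c n"]] show ?thesis
      by (simp add: norm_mult mult.assoc)
  qed
  note le1 = weighted_le[OF \<kappa>_le] and le2 = weighted_le[OF p_le]
  have le3: "norm (of_real (1 + (a n)\<^sup>2) * (c n * \<kappa> n) + of_real (a n) * (c n * p n))
               \<le> norm (c n) * (1 + (a n)\<^sup>2) * (L + C)" for n
  proof -
    have "norm (of_real (1 + (a n)\<^sup>2) * (c n * \<kappa> n)) \<le> norm (c n) * (1 + (a n)\<^sup>2) * L"
    proof -
      have "norm (complex_of_real (1 + (a n)\<^sup>2)) = 1 + (a n)\<^sup>2"
        unfolding norm_of_real by simp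
      thus ?thesis
        unfolding norm_mult using mult_left_mono[OF \<kappa>_le[of n], of "norm (c n) * (1 + (a n)\<^sup>2)"]
        by (simp add: mult_ac)
    qed
    moreover have "norm (of_real (a n) * (c n * p n)) \<le> norm (c n) * (1 + (a n)\<^sup>2) * C"
    proof -
      have "\<bar>a n\<bar> * norm (p n) \<le> (1 + (a n)\<^sup>2) * C"
        using one_le(2)[of n] p_le[of n] by (intro mult_mono) auto
      from mult_left_mono[OF this, of "norm (c n)"] show ?thesis
        by (simp add: norm_mult mult_ac)
    qed
    ultimately show ?thesis
      using norm_triangle_ineq[of "of_real (1 + (a n)\<^sup>2) * (c n * \<kappa> n)" "of_real (a n) * (c n * p n)"]
      by (simp add: distrib_left)
  qed
  have sum_if: "f summable_on UNIV" if "\<And>n. norm (f n) \<le> norm (c n) * (1 + (a n)\<^sup>2) * E"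
    for f :: "int \<Rightarrow> complex" and E
    by (rule summable_on_norm_comparison[OF summable_on_cmult_left[OF weight] that])
  have "of_real (1 + x\<^sup>2) * (\<Sum>\<^sub>\<infinity>n. c n * \<kappa> n) =
        of_real (1 + x\<^sup>2) * (\<Sum>\<^sub>\<infinity>n. c n * \<kappa> n) + of_real (- x) * (\<Sum>\<^sub>\<infinity>n. c n * p n)"
    using cancel[of x] by (simp add: p_def \<kappa>_def)
  also have "\<dots> = (\<Sum>\<^sub>\<infinity>n. of_real (1 + x\<^sup>2) * (c n * \<kappa> n) + of_real (- x) * (c n * p n))"
    by (subst infsum_add)
       (simp_all only: infsum_cmult_right' summable_on_cmult_right sum_if[OF le1] sum_if[OF le2])
  also have "\<dots> = (\<Sum>\<^sub>\<infinity>n. of_real (1 + (a n)\<^sup>2) * (c n * \<kappa> n) + of_real (a n) * (c n * p n))"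
    by (intro infsum_cong) (simp add: p_def power2_eq_square algebra_simps)
  finally have "norm (of_real (1 + x\<^sup>2) * (\<Sum>\<^sub>\<infinity>n. c n * \<kappa> n)) =
    norm (\<Sum>\<^sub>\<infinity>n. of_real (1 + (a n)\<^sup>2) * (c n * \<kappa> n) + of_real (a n) * (c n * p n))" by simp
  also have "\<dots> \<le> (\<Sum>\<^sub>\<infinity>n. norm (c n) * (1 + (a n)\<^sup>2) * (L + C))"
  proof (rule norm_infsum_le)
    show "((\<lambda>n. of_real (1 + (a n)\<^sup>2) * (c n * \<kappa> n) + of_real (a n) * (c n * p n)) has_sum
            (\<Sum>\<^sub>\<infinity>n. of_real (1 + (a n)\<^sup>2) * (c n * \<kappa> n) + of_real (a n) * (c n * p n))) UNIV"
      by (intro has_sum_infsum sum_if[OF le3])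
    show "((\<lambda>n. norm (c n) * (1 + (a n)\<^sup>2) * (L + C)) has_sum
            (\<Sum>\<^sub>\<infinity>n. norm (c n) * (1 + (a n)\<^sup>2) * (L + C))) UNIV"
      by (intro has_sum_infsum summable_on_cmult_left weight)
  qed (rule le3)
  finally show "norm (\<Sum>\<^sub>\<infinity>n. c n * band_kernel m (x - a n)) * (1 + x\<^sup>2)
          \<le> (\<Sum>\<^sub>\<infinity>n. norm (c n) * (1 + (a n)\<^sup>2) * (L + C))"
    unfolding \<kappa>_def norm_mult norm_of_real by (simp add: mult.commute)
qed

end

section \<open>The three kernels\<close>

definition sinc_band :: "real \<Rightarrow> complex" where
  "sinc_band t = indicator {-(1/2)..1/2} t"

definition fejer_band :: "real \<Rightarrow> complex" where
  "fejer_band t = of_real (max 0 (1 - \<bar>t\<bar>))"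

text \<open>
  The constant normalises the kernel to \<open>(sin (\<pi> u) / \<pi>)\<^sup>2 / u\<close>, the factor that accompanies the
  derivative values in Hermite interpolation.
\<close>

definition sign_band :: "real \<Rightarrow> complex" where
  "sign_band t = - \<i> / (2 * pi) * of_real (sgn t) * indicator {-1..1} t"

lemma integrable_band:
  assumes "m \<in> borel_measurable borel" and "\<And>t. norm (m t) \<le> indicator {-1..1} t"
  shows "integrable lborel (m :: real \<Rightarrow> complex)"
proof (rule Bochner_Integration.integrable_bound)
  show "integrable lborel (indicator {-1..1} :: real \<Rightarrow> real)" by simp
qed (use assms in auto)

lemma norm_sinc_band_le: "norm (sinc_band t) \<le> indicator {-1..1} t"
  by (auto simp: sinc_band_def indicator_def)

lemma norm_fejer_band_le: "norm (fejer_band t) \<le> indicator {-1..1} t"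
  by (auto simp: fejer_band_def indicator_def)

lemma norm_sign_band_le: "norm (sign_band t) \<le> indicator {-1..1} t"
proof -
  have "1 / (2 * pi) \<le> 1" using pi_gt3 by (simp add: field_simps)
  thus ?thesis
    by (auto simp: sign_band_def indicator_def norm_mult norm_divide sgn_if)
qed

lemma integrable_sinc_band: "integrable lborel sinc_band"
  by (rule integrable_band[OF _ norm_sinc_band_le]) (simp add: sinc_band_def[abs_def])

lemma integrable_fejer_band: "integrable lborel fejer_band"
  by (rule integrable_band[OF _ norm_fejer_band_le]) (simp add: fejer_band_def[abs_def])

lemma integrable_sign_band: "integrable lborel sign_band"
  by (rule integrable_band[OF _ norm_sign_band_le]) (simp add: sign_band_def[abs_def])

lemma has_vector_derivative_cis_mult [derivative_intros]:
  "((\<lambda>t. cis (w * t)) has_vector_derivative \<i> * of_real w * cis (w * t)) (at t within S)"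
  unfolding cis_conv_exp of_real_mult
  by (auto intro!: has_vector_derivative_real_field derivative_eq_intros simp: mult_ac)

lemma has_vector_derivative_mult_cis:
  assumes "(f has_vector_derivative f') (at t within S)"
  shows "((\<lambda>t. f t * cis (w * t)) has_vector_derivative
           (f' + \<i> * of_real w * f t) * cis (w * t)) (at t within S)"
  using has_vector_derivative_mult[OF assms has_vector_derivative_cis_mult]
  by (rule has_vector_derivative_eq_rhs) (simp add: algebra_simps)

lemma cis_plus_cis_minus: "cis (2 * x) + cis (- (2 * x)) - 2 = - of_real (4 * (sin x)\<^sup>2)"
  by (simp add: complex_eq_iff cos_double_sin)

text \<open>
  The kernels are stated in multiplied form, which holds at \<open>u = 0\<close> too and avoids case
  distinctions. Their values come from antiderivatives of multiples of \<open>\<i> w cis (w t)\<close>, where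
  \<open>w = 2 \<pi> u\<close>.
\<close>

lemma sinc_band_kernel: "of_real u * band_kernel sinc_band u = of_real (sin (pi * u) / pi)"
proof -
  define w where "w = 2 * pi * u"
  have "has_bochner_integral lborel
          (\<lambda>t. indicator {-(1/2)..1/2} t *\<^sub>R (\<i> * of_real w * cis (w * t)))
          (cis (w * (1/2)) - cis (w * (-(1/2))))"
    by (intro has_bochner_integral_FTC_Icc derivative_intros continuous_intros) auto
  hence "(LINT t|lborel. indicator {-(1/2)..1/2} t *\<^sub>R (\<i> * of_real w * cis (w * t))) =
           cis (pi * u) - cis (- (pi * u))"
    by (simp add: has_bochner_integral_iff w_def)
  also have "(LINT t|lborel. indicator {-(1/2)..1/2} t *\<^sub>R (\<i> * of_real w * cis (w * t))) =
      (LINT t|lborel. \<i> * of_real w * (sinc_band t * cis (2 * pi * (u * t))))"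
    by (intro Bochner_Integration.integral_cong)
       (auto simp: sinc_band_def w_def mult_ac split: split_indicator)
  also have "\<dots> = \<i> * of_real w * band_kernel sinc_band u"
    by (simp add: band_kernel_def)
  also have "cis (pi * u) - cis (- (pi * u)) = 2 * \<i> * of_real (sin (pi * u))"
    by (simp add: complex_eq_iff)
  finally show ?thesis
    by (simp add: w_def field_simps)
qed

lemma sign_band_kernel: "of_real u * band_kernel sign_band u = of_real ((sin (pi * u) / pi)\<^sup>2)"
proof -
  define w where "w = 2 * pi * u"
  have "has_bochner_integral lborel
          (\<lambda>t. indicator {a..b} t *\<^sub>R (\<i> * of_real w * cis (w * t))) (cis (w * b) - cis (w * a))"
    if "a \<le> b" for a b
    using that by (intro has_bochner_integral_FTC_Icc derivative_intros continuous_intros) auto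
  from has_bochner_integral_diff[OF this[of 0 1] this[of "-1" 0]]
  have "(LINT t|lborel. indicator {0..1} t *\<^sub>R (\<i> * of_real w * cis (w * t)) -
            indicator {-1..0} t *\<^sub>R (\<i> * of_real w * cis (w * t))) = cis w + cis (- w) - 2"
    by (simp add: has_bochner_integral_iff)
  also have "(LINT t|lborel. indicator {0..1} t *\<^sub>R (\<i> * of_real w * cis (w * t)) -
            indicator {-1..0} t *\<^sub>R (\<i> * of_real w * cis (w * t))) =
      (LINT t|lborel. - (2 * pi * of_real w) * (sign_band t * cis (2 * pi * (u * t))))"
    by (intro Bochner_Integration.integral_cong)
       (auto simp: sign_band_def w_def mult_ac sgn_if split: split_indicator)
  also have "\<dots> = - (2 * pi * of_real w) * band_kernel sign_band u"
    unfolding band_kernel_def by (rule integral_mult_right_zero)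
  also have "cis w + cis (- w) - 2 = - of_real (4 * (sin (pi * u))\<^sup>2)"
    using cis_plus_cis_minus[of "pi * u"] by (simp add: w_def mult_ac)
  finally show ?thesis
    by (simp add: w_def field_simps power2_eq_square)
qed

text \<open>
  Integration by parts on either half of the tent function: the antiderivatives are
  \<open>(\<i> w (1 - t) + 1) cis (w t)\<close> on \<open>[0, 1]\<close> and \<open>(\<i> w (1 + t) - 1) cis (w t)\<close> on \<open>[-1, 0]\<close>, and the
  terms linear in \<open>w\<close> at the common endpoint \<open>0\<close> cancel.
\<close>

lemma fejer_band_kernel: "of_real (u\<^sup>2) * band_kernel fejer_band u = of_real ((sin (pi * u) / pi)\<^sup>2)"
proof -
  define w where "w = 2 * pi * u"
  define f g where "f t = (\<i> * of_real w)\<^sup>2 * (1 - of_real t) * cis (w * t)"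
    and "g t = (\<i> * of_real w)\<^sup>2 * (1 + of_real t) * cis (w * t)" for t
  have I1: "has_bochner_integral lborel (\<lambda>t. indicator {0..1} t *\<^sub>R f t)
          ((\<i> * of_real w * (1 - of_real 1) + 1) * cis (w * 1) -
           (\<i> * of_real w * (1 - of_real 0) + 1) * cis (w * 0))"
  proof (rule has_bochner_integral_FTC_Icc)
    show "((\<lambda>t. (\<i> * of_real w * (1 - of_real t) + 1) * cis (w * t)) has_vector_derivative f t)
            (at t within {0..1})" for t
      by (rule has_vector_derivative_eq_rhs[OF has_vector_derivative_mult_cis[where f' = "- \<i> * of_real w"]])
         (auto intro!: has_vector_derivative_real_field derivative_eq_intros
               simp: f_def power2_eq_square algebra_simps)
  qed (auto simp: f_def intro!: continuous_intros)
  have I2: "has_bochner_integral lborel (\<lambda>t. indicator {-1..0} t *\<^sub>R g t)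
          ((\<i> * of_real w * (1 + of_real 0) - 1) * cis (w * 0) -
           (\<i> * of_real w * (1 + of_real (-1)) - 1) * cis (w * (-1)))"
  proof (rule has_bochner_integral_FTC_Icc)
    show "((\<lambda>t. (\<i> * of_real w * (1 + of_real t) - 1) * cis (w * t)) has_vector_derivative g t)
            (at t within {-1..0})" for t
      by (rule has_vector_derivative_eq_rhs[OF has_vector_derivative_mult_cis[where f' = "\<i> * of_real w"]])
         (auto intro!: has_vector_derivative_real_field derivative_eq_intros
               simp: g_def power2_eq_square algebra_simps)
  qed (auto simp: g_def intro!: continuous_intros)
  from has_bochner_integral_add[OF I1 I2]
  have "(LINT t|lborel. indicator {0..1} t *\<^sub>R f t + indicator {-1..0} t *\<^sub>R g t) =
      cis w + cis (- w) - 2"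
    by (simp add: has_bochner_integral_iff)
  \<comment> \<open>The two closed halves overlap in the point \<open>0\<close>, a null set.\<close>
  also have "(LINT t|lborel. indicator {0..1} t *\<^sub>R f t + indicator {-1..0} t *\<^sub>R g t) =
      (LINT t|lborel. - of_real (w\<^sup>2) * (fejer_band t * cis (2 * pi * (u * t))))"
  proof (rule integral_discrete_difference[where X = "{0}"])
    fix t :: real
    assume "t \<notin> {0}"
    moreover have "cis (2 * pi * (u * t)) = cis (w * t)"
      by (simp add: w_def mult.assoc)
    moreover have "(\<i> * of_real w)\<^sup>2 = - of_real (w\<^sup>2)"
      by (simp add: power_mult_distrib)
    ultimately show "indicator {0..1} t *\<^sub>R f t + indicator {-1..0} t *\<^sub>R g t =
        - of_real (w\<^sup>2) * (fejer_band t * cis (2 * pi * (u * t)))"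
      by (auto simp: fejer_band_def f_def g_def indicator_def max_def)
  qed auto
  also have "\<dots> = - of_real (w\<^sup>2) * band_kernel fejer_band u"
    unfolding band_kernel_def by (rule integral_mult_right_zero)
  also have "cis w + cis (- w) - 2 = - of_real (4 * (sin (pi * u))\<^sup>2)"
    using cis_plus_cis_minus[of "pi * u"] by (simp add: w_def mult_ac)
  finally have "of_real (4 * pi\<^sup>2) * (of_real (u\<^sup>2) * band_kernel fejer_band u) =
      of_real (4 * pi\<^sup>2) * complex_of_real ((sin (pi * u) / pi)\<^sup>2)"
    by (simp add: w_def power_mult_distrib power_divide mult.assoc)
  thus ?thesis
    by (rule mult_left_cancel[THEN iffD1, rotated]) simp
qed

section \<open>The Fourier transform of a sampling series\<close>

text \<open>
  A jump of \<open>m\<close> at \<open>s\<close> does no harm if the trigonometric series vanishes there, because then the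
  product is still continuous at \<open>s\<close>.
\<close>

theorem fourier_sampling_series:
  fixes c :: "int \<Rightarrow> complex" and a :: "int \<Rightarrow> real"
  assumes c: "(\<lambda>n. norm (c n)) summable_on UNIV"
    and m: "integrable lborel m" and bound: "\<And>t. norm (m t) \<le> indicator {-1..1} t"
    and int: "integrable lborel (\<lambda>x. \<Sum>\<^sub>\<infinity>n. c n * band_kernel m (x - a n))"
    and cont: "isCont m s \<or> trig_series c a s = 0"
  shows "(LINT x|lborel. (\<Sum>\<^sub>\<infinity>n. c n * band_kernel m (x - a n)) * cis (- (2 * pi * (x * s)))) =
         m s * trig_series c a s"
proof (rule fourier_inversion_at_continuity_point)
  have m_le: "norm (m t) \<le> 1" for t
    using bound[of t] by (rule order_trans) (simp add: indicator_def)
  show "integrable lborel (\<lambda>t. m t * trig_series c a t)"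
    by (rule integrable_mult_trig_series[OF c m])
  show "norm (m t * trig_series c a t) \<le> 1 * (\<Sum>\<^sub>\<infinity>n. norm (c n))" for t
    unfolding norm_mult by (intro mult_mono m_le norm_trig_series_le[OF c]) auto
  show "isCont (\<lambda>t. m t * trig_series c a t) s"
  proof (cases "isCont m s")
    case True
    thus ?thesis by (intro continuous_intros continuous_trig_series[OF c])
  next
    case False
    hence zero: "trig_series c a s = 0" using cont by simp
    have "((\<lambda>t. m t * trig_series c a t) \<longlongrightarrow> 0) (at s)"
    proof (rule Lim_null_comparison)
      show "\<forall>\<^sub>F t in at s. norm (m t * trig_series c a t) \<le> norm (trig_series c a t)"
        using m_le by (intro always_eventually allI) (simp add: norm_mult mult_left_le_one_le)
      have "(trig_series c a \<longlongrightarrow> 0) (at s)"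
        using continuous_trig_series[OF c, where a = a and t = s] zero by (simp add: isCont_def)
      thus "((\<lambda>t. norm (trig_series c a t)) \<longlongrightarrow> 0) (at s)"
        by (rule tendsto_norm_zero)
    qed
    thus ?thesis by (simp add: isCont_def zero)
  qed
qed (use int sampling_series_eq_integral[OF c m] in auto)

section \<open>Nodes and Gaussian coefficients\<close>

text \<open>
  The parameter \<open>k\<close> treats both sets of nodes at once: \<open>k = 0\<close> gives the integers, and \<open>k = 1\<close>
  the points \<open>n + 1 / 2\<close>. In either case \<open>n \<mapsto> - n - k\<close> reflects the nodes at the
  origin.
\<close>

definition node :: "int \<Rightarrow> int \<Rightarrow> real" where
  "node k n = of_int n + of_int k / 2"

lemma node_reflect: "node k (- n - k) = - node k n"
  by (simp add: node_def field_simps)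

lemma infsum_node_reflect: "(\<Sum>\<^sub>\<infinity>n. f (- n - k)) = (\<Sum>\<^sub>\<infinity>n::int. f n)"
proof (rule infsum_reindex_bij_betw)
  show "bij (\<lambda>n. - n - k)"
    by (rule bij_betw_byWitness[where f' = "\<lambda>n. - n - k"]) auto
qed

lemma infsum_odd_eq_0:
  fixes f :: "int \<Rightarrow> complex"
  assumes "\<And>n. f (- n - k) = - f n"
  shows "infsum f UNIV = 0"
  using infsum_node_reflect[of f k] by (simp add: assms infsum_uminus)

lemma summable_on_exp_abs_int: "(\<lambda>n::int. exp (- \<bar>real_of_int n\<bar>)) summable_on UNIV"
proof -
  have geo: "(\<lambda>n::nat. exp (- real n)) summable_on UNIV"
  proof -
    have "summable (\<lambda>n::nat. exp (- 1 :: real) ^ n)"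
      by (intro summable_geometric) simp
    thus ?thesis
      by (subst summable_on_UNIV_nonneg_real_iff) (simp_all flip: exp_of_nat_mult)
  qed
  have "(\<lambda>n::int. exp (- \<bar>real_of_int n\<bar>)) summable_on (range int)"
    using geo by (subst summable_on_reindex) (auto simp: o_def)
  moreover have "(\<lambda>n::int. exp (- \<bar>real_of_int n\<bar>)) summable_on (range (\<lambda>n. - int n))"
    using geo by (subst summable_on_reindex) (auto simp: o_def inj_on_def)
  ultimately have "(\<lambda>n::int. exp (- \<bar>real_of_int n\<bar>)) summable_on (range int \<union> range (\<lambda>n. - int n))"
    by (rule summable_on_union)
  also have "range int \<union> range (\<lambda>n. - int n) = UNIV"
  proof -
    have "n \<in> range int \<union> range (\<lambda>n. - int n)" for n
      by (cases n rule: int_cases2) auto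
    thus ?thesis by blast
  qed
  finally show ?thesis .
qed

definition gauss_weight :: "real \<Rightarrow> int \<Rightarrow> int \<Rightarrow> real" where
  "gauss_weight lam k n = exp (- (pi * lam * (node k n)\<^sup>2))"

lemma gauss_weight_pos [simp]: "gauss_weight lam k n > 0" "gauss_weight lam k n \<ge> 0"
  by (simp_all add: gauss_weight_def)

lemma gauss_weight_reflect: "gauss_weight lam k (- n - k) = gauss_weight lam k n"
  by (simp add: gauss_weight_def node_reflect)

text \<open>
  Completing the square gives \<open>B y - \<pi> \<lambda> y\<^sup>2 \<le> D - y\<close> with \<open>D = (B + 1)\<^sup>2 / (4 \<pi> \<lambda>)\<close>, so the terms are
  dominated by a two-sided geometric series. All other summability facts compare with this one:
  polynomial weights are absorbed in the exponential, and so is the growth of the theta series in a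
  horizontal strip.
\<close>

lemma summable_exp_gauss_weight:
  assumes "lam > 0"
  shows "(\<lambda>n. exp (B * \<bar>node k n\<bar>) * gauss_weight lam k n) summable_on UNIV"
proof (rule summable_on_comparison_test)
  define p where "p = pi * lam"
  define D where "D = (B + 1)\<^sup>2 / (4 * p)"
  have p: "p > 0" using assms by (simp add: p_def)
  show "(\<lambda>n::int. exp (D + \<bar>real_of_int k\<bar> / 2) * exp (- \<bar>real_of_int n\<bar>)) summable_on UNIV"
    by (intro summable_on_cmult_right summable_on_exp_abs_int)
  fix n :: int
  define y where "y = \<bar>node k n\<bar>"
  have "0 \<le> p * (y - (B + 1) / (2 * p))\<^sup>2" using p by simp
  also have "\<dots> = p * y\<^sup>2 - (B + 1) * y + D"
    using p by (simp add: D_def power2_eq_square field_simps)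
  finally have "B * y - p * y\<^sup>2 \<le> D - y" by (simp add: algebra_simps)
  moreover have "\<bar>real_of_int n\<bar> \<le> y + \<bar>real_of_int k\<bar> / 2"
    unfolding y_def node_def by linarith
  ultimately have "B * y + (- (p * y\<^sup>2)) \<le> D + \<bar>real_of_int k\<bar> / 2 + (- \<bar>real_of_int n\<bar>)"
    by linarith
  thus "exp (B * \<bar>node k n\<bar>) * gauss_weight lam k n \<le>
          exp (D + \<bar>real_of_int k\<bar> / 2) * exp (- \<bar>real_of_int n\<bar>)"
    unfolding gauss_weight_def exp_add[symmetric] exp_le_cancel_iff y_def p_def power2_abs .
qed simp

text \<open>
  The values and derivatives of the Gaussian at the nodes: an even and an odd sequence with respect
  to the reflection of the nodes.
\<close>

definition value_coeff :: "real \<Rightarrow> int \<Rightarrow> int \<Rightarrow> complex" where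
  "value_coeff lam k n = of_real (gauss_weight lam k n)"

definition slope_coeff :: "real \<Rightarrow> int \<Rightarrow> int \<Rightarrow> complex" where
  "slope_coeff lam k n = of_real (- (2 * pi * lam * node k n * gauss_weight lam k n))"

lemma gaussian_node: "gaussian lam (of_real (node k n)) = value_coeff lam k n"
proof -
  have "gaussian lam (of_real (node k n)) = exp (of_real (- (pi * lam * (node k n)\<^sup>2)))"
    by (simp add: gaussian_def)
  thus ?thesis by (simp only: exp_of_real value_coeff_def gauss_weight_def)
qed

lemma deriv_gaussian_node: "deriv (gaussian lam) (of_real (node k n)) = slope_coeff lam k n"
proof -
  have "(gaussian lam has_field_derivative - (2 * pi * lam * z * gaussian lam z)) (at z)" for z
    unfolding gaussian_def[abs_def] by (auto intro!: derivative_eq_intros)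
  from DERIV_imp_deriv[OF this, of "of_real (node k n)"] show ?thesis
    by (simp add: gaussian_node slope_coeff_def value_coeff_def)
qed

lemma value_coeff_reflect: "value_coeff lam k (- n - k) = value_coeff lam k n"
  by (simp add: value_coeff_def gauss_weight_reflect)

lemma slope_coeff_reflect: "slope_coeff lam k (- n - k) = - slope_coeff lam k n"
  by (simp add: slope_coeff_def gauss_weight_reflect node_reflect)

lemma one_plus_square_le_exp: "1 + y\<^sup>2 \<le> exp (2 * \<bar>y :: real\<bar>)"
proof -
  have "1 + y\<^sup>2 \<le> (1 + \<bar>y\<bar>)\<^sup>2"
    by (simp add: power2_sum)
  also have "\<dots> \<le> (exp \<bar>y\<bar>)\<^sup>2"
    by (intro power_mono) auto
  finally show ?thesis by (simp flip: exp_double)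
qed

context
  fixes lam :: real
  assumes lam: "lam > 0"
begin

lemma value_coeff_weighted_summable:
  "(\<lambda>n. norm (value_coeff lam k n) * (1 + (node k n)\<^sup>2)) summable_on UNIV"
proof (rule summable_on_comparison_test[OF summable_exp_gauss_weight[OF lam, of 2 k]])
  show "norm (value_coeff lam k n) * (1 + (node k n)\<^sup>2) \<le>
          exp (2 * \<bar>node k n\<bar>) * gauss_weight lam k n" for n
    using mult_right_mono[OF one_plus_square_le_exp, of "gauss_weight lam k n" "node k n"]
    by (simp add: value_coeff_def mult.commute)
qed simp

lemma slope_coeff_weighted_summable:
  "(\<lambda>n. norm (slope_coeff lam k n) * (1 + (node k n)\<^sup>2)) summable_on UNIV"
proof (rule summable_on_comparison_test[OF summable_on_cmult_right[OF
          summable_exp_gauss_weight[OF lam, of 3 k], of "2 * pi * lam"]])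
  show "norm (slope_coeff lam k n) * (1 + (node k n)\<^sup>2) \<le>
          2 * pi * lam * (exp (3 * \<bar>node k n\<bar>) * gauss_weight lam k n)" for n
  proof -
    have "\<bar>node k n\<bar> * (1 + (node k n)\<^sup>2) \<le> exp \<bar>node k n\<bar> * exp (2 * \<bar>node k n\<bar>)"
    proof (intro mult_mono one_plus_square_le_exp)
      show "\<bar>node k n\<bar> \<le> exp \<bar>node k n\<bar>"
        using exp_ge_add_one_self[of "\<bar>node k n\<bar>"] by linarith
    qed auto
    also have "\<dots> = exp (3 * \<bar>node k n\<bar>)"
      by (simp flip: exp_add)
    finally have "2 * pi * lam * gauss_weight lam k n * (\<bar>node k n\<bar> * (1 + (node k n)\<^sup>2)) \<le>
                  2 * pi * lam * gauss_weight lam k n * exp (3 * \<bar>node k n\<bar>)"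
      using lam by (intro mult_left_mono) auto
    thus ?thesis
      using lam by (simp add: slope_coeff_def norm_mult abs_mult mult_ac)
  qed
qed simp

lemmas value_coeff_abs_summable = coeff_abs_summable[OF value_coeff_weighted_summable]
lemmas slope_coeff_abs_summable = coeff_abs_summable[OF slope_coeff_weighted_summable]

end

section \<open>Theta functions as trigonometric series\<close>

text \<open>
  Both theta functions at purely imaginary parameter: \<open>theta1\<close> for \<open>k = 1\<close> and \<open>theta3\<close> for \<open>k = 0\<close>.
\<close>

definition node_theta :: "real \<Rightarrow> int \<Rightarrow> complex \<Rightarrow> complex" where
  "node_theta lam k v = (\<Sum>\<^sub>\<infinity>n. value_coeff lam k n * e_fun (of_real (node k n) * v))"

lemma nome_pow_node:
  "nome_pow (\<i> * of_real lam) ((of_real (node k n))\<^sup>2) = value_coeff lam k n"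
proof -
  have "of_real pi * \<i> * (\<i> * of_real lam) * (of_real (node k n))\<^sup>2 =
          complex_of_real (- (pi * lam * (node k n)\<^sup>2))"
    by (simp add: algebra_simps)
  thus ?thesis by (simp only: nome_pow_def exp_of_real value_coeff_def gauss_weight_def)
qed

lemma theta1_eq: "theta1 v (\<i> * of_real lam) = node_theta lam 1 v"
  unfolding theta1_def node_theta_def nome_pow_node[symmetric] by (simp add: node_def)

lemma theta3_eq: "theta3 v (\<i> * of_real lam) = node_theta lam 0 v"
  unfolding theta3_def node_theta_def nome_pow_node[symmetric] by (simp add: node_def)

lemma e_fun_of_real: "e_fun (of_real y) = cis (2 * pi * y)"
  by (simp add: e_fun_def cis_conv_exp mult_ac)

lemma trig_series_value_coeff:
  "trig_series (value_coeff lam k) (node k) t = node_theta lam k (of_real t)"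
proof -
  have "trig_series (value_coeff lam k) (node k) t =
          (\<Sum>\<^sub>\<infinity>n. value_coeff lam k (- n - k) * cis (- (2 * pi * (node k (- n - k) * t))))"
    unfolding trig_series_def by (rule infsum_node_reflect[symmetric])
  also have "\<dots> = node_theta lam k (of_real t)"
    by (simp add: value_coeff_reflect node_reflect node_theta_def e_fun_of_real flip: of_real_mult)
  finally show ?thesis .
qed

text \<open>
  In the disc of radius \<open>1\<close> around \<open>t\<close> the imaginary part is at most \<open>1\<close>, so the terms are dominated
  by \<open>exp (2 \<pi> \<bar>a\<bar>)\<close> times the Gaussian weight. Uniform convergence of holomorphic functions permits
  termwise differentiation.
\<close>

lemma deriv_node_theta:
  assumes lam: "lam > 0"
  shows "deriv (node_theta lam k) (of_real t) =
     (\<Sum>\<^sub>\<infinity>n. value_coeff lam k n * (2 * pi * \<i> * of_real (node k n) * cis (2 * pi * (node k n * t))))"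
proof -
  define A where "A = ball (complex_of_real t) 1"
  define f where "f n v = value_coeff lam k n * e_fun (of_real (node k n) * v)" for n v
  define f' where "f' n v = value_coeff lam k n * (2 * pi * \<i> * of_real (node k n) *
                             e_fun (of_real (node k n) * v))" for n v
  have deriv_f: "(f n has_field_derivative f' n v) (at v)" for n v
    unfolding f_def[abs_def] f'_def e_fun_def by (auto intro!: derivative_eq_intros)
  have ulim: "uniform_limit A (\<lambda>X v. \<Sum>n\<in>X. f n v) (\<lambda>v. \<Sum>\<^sub>\<infinity>n. f n v) (finite_subsets_at_top UNIV)"
  proof (rule Weierstrass_m_test_general[OF _ summable_exp_gauss_weight[OF lam, of "2 * pi" k]])
    fix n v assume "v \<in> A"
    hence "norm (v - of_real t) < 1" by (simp add: A_def dist_norm norm_minus_commute)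
    hence Im: "\<bar>Im v\<bar> \<le> 1"
      using abs_Im_le_cmod[of "v - of_real t"] by simp
    have "norm (e_fun (of_real (node k n) * v)) = exp (2 * pi * (- (node k n * Im v)))"
      by (simp add: e_fun_def norm_exp_eq_Re)
    also have "\<dots> \<le> exp (2 * pi * \<bar>node k n\<bar>)"
    proof -
      have "- (node k n * Im v) \<le> \<bar>node k n\<bar> * \<bar>Im v\<bar>"
        by (simp flip: abs_mult)
      also have "\<dots> \<le> \<bar>node k n\<bar>" using Im by (rule mult_left_le) simp
      finally have "2 * pi * (- (node k n * Im v)) \<le> 2 * pi * \<bar>node k n\<bar>"
        by (intro mult_left_mono) auto
      thus ?thesis by simp
    qed
    finally show "norm (f n v) \<le> exp (2 * pi * \<bar>node k n\<bar>) * gauss_weight lam k n"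
      by (simp add: f_def norm_mult value_coeff_def mult.commute mult_left_mono)
  qed
  have "((\<lambda>X. (deriv ^^ 1) (\<lambda>v. \<Sum>n\<in>X. f n v) (of_real t)) \<longlongrightarrow>
            (deriv ^^ 1) (\<lambda>v. \<Sum>\<^sub>\<infinity>n. f n v) (of_real t)) (finite_subsets_at_top UNIV)"
  proof (rule higher_deriv_complex_uniform_limit[OF ulim])
    have "(\<lambda>v. \<Sum>n\<in>X. f n v) holomorphic_on A" for X
      using deriv_f by (intro holomorphic_intros)
        (auto simp: holomorphic_on_def field_differentiable_def intro: has_field_derivative_at_within)
    thus "\<forall>\<^sub>F X in finite_subsets_at_top UNIV. (\<lambda>v. \<Sum>n\<in>X. f n v) holomorphic_on A"
      by simp
  qed (auto simp: A_def)
  moreover have "deriv (\<lambda>v. \<Sum>n\<in>X. f n v) (of_real t) = (\<Sum>n\<in>X. f' n (of_real t))" for X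
    by (intro DERIV_imp_deriv DERIV_sum deriv_f)
  ultimately have "((\<lambda>X. \<Sum>n\<in>X. f' n (of_real t)) \<longlongrightarrow> deriv (node_theta lam k) (of_real t))
      (finite_subsets_at_top UNIV)"
    by (simp add: f_def node_theta_def[abs_def])
  hence "((\<lambda>n. f' n (of_real t)) has_sum deriv (node_theta lam k) (of_real t)) UNIV"
    by (simp add: has_sum_def)
  thus ?thesis
    by (simp add: f'_def infsumI e_fun_of_real flip: of_real_mult)
qed

text \<open>
  The Gaussian satisfies \<open>G' a = - 2 \<pi> \<lambda> a G a\<close>, so its derivative values are, up to the factor
  \<open>- \<i> \<lambda>\<close>, the coefficients of the differentiated theta series.
\<close>

lemma trig_series_slope_coeff:
  assumes lam: "lam > 0"
  shows "trig_series (slope_coeff lam k) (node k) t =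
           - \<i> * of_real lam * deriv (node_theta lam k) (of_real t)"
proof -
  have "trig_series (slope_coeff lam k) (node k) t =
          (\<Sum>\<^sub>\<infinity>n. slope_coeff lam k (- n - k) * cis (- (2 * pi * (node k (- n - k) * t))))"
    unfolding trig_series_def by (rule infsum_node_reflect[symmetric])
  also have "\<dots> = (\<Sum>\<^sub>\<infinity>n. - \<i> * of_real lam * (value_coeff lam k n *
                     (2 * pi * \<i> * of_real (node k n) * cis (2 * pi * (node k n * t)))))"
    unfolding slope_coeff_reflect node_reflect
    by (intro infsum_cong) (simp add: slope_coeff_def value_coeff_def)
  also have "\<dots> = - \<i> * of_real lam * deriv (node_theta lam k) (of_real t)"
    unfolding deriv_node_theta[OF lam] by (rule infsum_cmult_right')
  finally show ?thesis .
qed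

section \<open>Cancellation from the reflection of the nodes\<close>

lemma sin_add_pi_int:
  "sin (x + pi * real_of_int j) = (if even j then sin x else - sin x)"
  by (simp add: sin_add cos_npi_int sin_npi_int)

lemma sin_node_reflect:
  "sin (pi * (x - node k (- n - k))) = (if even k then 1 else - 1) * sin (pi * (x - node k n))"
proof -
  have "pi * (x - node k (- n - k)) = pi * (x - node k n) + pi * real_of_int (2 * n + k)"
    by (simp add: node_def field_simps)
  thus ?thesis
    using sin_add_pi_int[of "pi * (x - node k n)" "2 * n + k"] by simp
qed

lemma sin_squared_node: "(sin (pi * (x - node k n)))\<^sup>2 = (sin (pi * (x - of_int k / 2)))\<^sup>2"
proof -
  have "pi * (x - of_int k / 2) = pi * (x - node k n) + pi * real_of_int n"
    by (simp add: node_def field_simps)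
  thus ?thesis
    using sin_add_pi_int[of "pi * (x - node k n)" n] by simp
qed

lemma cis_node_reflect:
  "cis (- (2 * pi * (node k (- n - k) * (of_int j / 2)))) =
     (if even (j * k) then 1 else - 1) * cis (- (2 * pi * (node k n * (of_int j / 2))))"
proof -
  have "- (2 * pi * (node k (- n - k) * (of_int j / 2))) =
          pi * real_of_int (j * (2 * n + k)) + - (2 * pi * (node k n * (of_int j / 2)))"
    by (simp add: node_def field_simps)
  moreover have "cis (pi * real_of_int (j * (2 * n + k))) = (if even (j * k) then 1 else - 1)"
    using cos_npi_int[of "j * (2 * n + k)"] sin_npi_int[of "j * (2 * n + k)"]
    by (simp add: complex_eq_iff)
  ultimately show ?thesis
    by (simp only: cis_mult[symmetric])
qed

text \<open>
  At a half-integer point \<open>j / 2\<close> the characters at \<open>a\<close> and \<open>- a\<close> agree up to the sign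
  \<open>(- 1) ^ (j k)\<close>, since \<open>2 a\<close> has the parity of \<open>k\<close>. If this sign is \<open>- 1\<close>, the even coefficients
  cancel in pairs, and if it is \<open>1\<close>, the odd ones do. This happens at all jumps of the two
  discontinuous spectra.
\<close>

lemma trig_series_value_coeff_eq_0:
  assumes "odd (j * k)"
  shows "trig_series (value_coeff lam k) (node k) (of_int j / 2) = 0"
  unfolding trig_series_def using assms
  by (intro infsum_odd_eq_0[where k = k]) (simp only: value_coeff_reflect cis_node_reflect, simp)

lemma trig_series_slope_coeff_eq_0:
  assumes "even (j * k)"
  shows "trig_series (slope_coeff lam k) (node k) (of_int j / 2) = 0"
  unfolding trig_series_def using assms
  by (intro infsum_odd_eq_0[where k = k]) (simp only: slope_coeff_reflect cis_node_reflect, simp)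

lemma abs_sin_div_pi_le: "\<bar>sin x / pi\<bar> \<le> 1"
proof -
  have "\<bar>sin x\<bar> \<le> pi" using pi_gt3 abs_sin_le_one[of x] by linarith
  thus ?thesis by (simp add: abs_divide)
qed

lemma sin_div_pi_square_le: "(sin x / pi)\<^sup>2 \<le> 1"
  using abs_sin_div_pi_le by (rule abs_square_le_1[THEN iffD2])

lemma fejer_band_kernel_decay: "norm (band_kernel fejer_band u) * (1 + u\<^sup>2) \<le> (LINT t|lborel. norm (fejer_band t)) + 1"
proof -
  have "norm (of_real (u\<^sup>2) * band_kernel fejer_band u) = (sin (pi * u) / pi)\<^sup>2"
    unfolding fejer_band_kernel norm_of_real by simp
  hence "norm (band_kernel fejer_band u) * u\<^sup>2 = (sin (pi * u) / pi)\<^sup>2"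
    by (simp add: norm_mult norm_power mult.commute)
  also have "\<dots> \<le> 1"
    by (rule sin_div_pi_square_le)
  finally show ?thesis
    using norm_band_kernel_le[OF integrable_fejer_band, of u] by (simp add: distrib_left)
qed

context
  fixes lam :: real
  assumes lam: "lam > 0"
begin

lemma integrable_value_sinc:
  assumes "odd k"
  shows "integrable lborel (\<lambda>x. \<Sum>\<^sub>\<infinity>n. value_coeff lam k n * band_kernel sinc_band (x - node k n))"
proof (rule sampling_series_integrable_cancelling[OF value_coeff_weighted_summable[OF lam] integrable_sinc_band])
  show "norm (of_real u * band_kernel sinc_band u) \<le> 1" for u
    unfolding sinc_band_kernel norm_of_real by (rule abs_sin_div_pi_le)
  show "(\<Sum>\<^sub>\<infinity>n. value_coeff lam k n * (of_real (x - node k n) * band_kernel sinc_band (x - node k n))) = 0" for x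
    unfolding sinc_band_kernel
    by (rule infsum_odd_eq_0[where k = k]) (use assms in \<open>simp only: value_coeff_reflect sin_node_reflect, simp\<close>)
qed

lemma integrable_slope_sign:
  "integrable lborel (\<lambda>x. \<Sum>\<^sub>\<infinity>n. slope_coeff lam k n * band_kernel sign_band (x - node k n))"
proof (rule sampling_series_integrable_cancelling[OF slope_coeff_weighted_summable[OF lam] integrable_sign_band])
  show "norm (of_real u * band_kernel sign_band u) \<le> 1" for u
    unfolding sign_band_kernel norm_of_real abs_power2 by (rule sin_div_pi_square_le)
  show "(\<Sum>\<^sub>\<infinity>n. slope_coeff lam k n * (of_real (x - node k n) * band_kernel sign_band (x - node k n))) = 0" for x
    unfolding sign_band_kernel power_divide sin_squared_node
    by (rule infsum_odd_eq_0[where k = k]) (simp add: slope_coeff_reflect)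
qed

lemma integrable_value_fejer:
  "integrable lborel (\<lambda>x. \<Sum>\<^sub>\<infinity>n. value_coeff lam k n * band_kernel fejer_band (x - node k n))"
  by (rule sampling_series_integrable_quadratic_kernel[OF value_coeff_weighted_summable[OF lam]
        integrable_fejer_band fejer_band_kernel_decay])

section \<open>Fourier transforms of the three series\<close>

text \<open>
  The spectrum jumps at \<open>s = \<plusminus> 1 / 2\<close>, where the trigonometric series vanishes because \<open>k\<close> is odd.
\<close>

lemma fourier_value_sinc:
  assumes k: "odd k" and s: "\<bar>s\<bar> \<le> 1 / 2"
  shows "(LINT x|lborel. (\<Sum>\<^sub>\<infinity>n. value_coeff lam k n * band_kernel sinc_band (x - node k n)) *
            cis (- (2 * pi * (x * s)))) = node_theta lam k (of_real s)"
proof -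
  have "isCont sinc_band s \<or> trig_series (value_coeff lam k) (node k) s = 0"
  proof (cases "\<bar>s\<bar> = 1 / 2")
    case True
    then consider "s = of_int 1 / 2" | "s = of_int (- 1) / 2" by fastforce
    thus ?thesis
    proof cases
      case 1
      show ?thesis
        unfolding 1 by (intro disjI2 trig_series_value_coeff_eq_0) (use k in simp)
    next
      case 2
      show ?thesis
        unfolding 2 by (intro disjI2 trig_series_value_coeff_eq_0) (use k in simp)
    qed
  next
    case False
    hence "s \<in> {- (1/2)<..<1/2}" using s by auto
    hence "\<forall>\<^sub>F t in nhds s. t \<in> {- (1/2)<..<1/2}"
      by (intro eventually_nhds_in_open) auto
    hence "\<forall>\<^sub>F t in nhds s. sinc_band t = 1"
      by eventually_elim (simp add: sinc_band_def)
    thus ?thesis by (simp add: isCont_cong)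
  qed
  from fourier_sampling_series[OF value_coeff_abs_summable[OF lam] integrable_sinc_band
         norm_sinc_band_le integrable_value_sinc[OF k] this]
  moreover have "sinc_band s = 1"
    using s by (auto simp: sinc_band_def indicator_def abs_le_iff)
  ultimately show ?thesis
    by (simp add: trig_series_value_coeff)
qed

lemma fourier_value_fejer:
  assumes s: "\<bar>s\<bar> \<le> 1"
  shows "(LINT x|lborel. (\<Sum>\<^sub>\<infinity>n. value_coeff lam k n * band_kernel fejer_band (x - node k n)) *
            cis (- (2 * pi * (x * s)))) = of_real (1 - \<bar>s\<bar>) * node_theta lam k (of_real s)"
proof -
  have "isCont fejer_band s"
    unfolding fejer_band_def[abs_def] by (intro continuous_intros)
  from fourier_sampling_series[OF value_coeff_abs_summable[OF lam] integrable_fejer_band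
         norm_fejer_band_le integrable_value_fejer disjI1[OF this]]
  show ?thesis
    using s by (simp add: trig_series_value_coeff fejer_band_def)
qed

text \<open>
  The spectrum jumps at \<open>- 1\<close>, \<open>0\<close> and \<open>1\<close>, that is, at \<open>j / 2\<close> with \<open>j\<close> even; the odd coefficients
  cancel there for either parity of \<open>k\<close>.
\<close>

lemma fourier_slope_sign:
  assumes s: "\<bar>s\<bar> \<le> 1"
  shows "(LINT x|lborel. (\<Sum>\<^sub>\<infinity>n. slope_coeff lam k n * band_kernel sign_band (x - node k n)) *
            cis (- (2 * pi * (x * s)))) =
         - of_real (inverse (2 * pi) * lam * sgn s) * deriv (node_theta lam k) (of_real s)"
proof -
  have "isCont sign_band s \<or> trig_series (slope_coeff lam k) (node k) s = 0"
  proof (cases "s = 0 \<or> \<bar>s\<bar> = 1")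
    case True
    hence "s = of_int (2 * 0) / 2 \<or> s = of_int (2 * 1) / 2 \<or> s = of_int (2 * (- 1)) / 2"
      by auto
    then obtain i where i: "s = of_int (2 * i) / 2" by metis
    show ?thesis
      unfolding i by (intro disjI2 trig_series_slope_coeff_eq_0) simp
  next
    case False
    define S where "S = (if s > 0 then {0<..<1} else {-1<..<0 :: real})"
    have "\<forall>\<^sub>F t in nhds s. t \<in> S"
      using False s by (intro eventually_nhds_in_open) (auto simp: S_def)
    hence "\<forall>\<^sub>F t in nhds s. sign_band t = sign_band s"
      by (rule eventually_mono) (use False s in \<open>auto simp: S_def sign_band_def sgn_if split: if_splits\<close>)
    thus ?thesis by (simp add: isCont_cong)
  qed
  from fourier_sampling_series[OF slope_coeff_abs_summable[OF lam] integrable_sign_band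
         norm_sign_band_le integrable_slope_sign this]
  show ?thesis
    using s by (simp add: trig_series_slope_coeff[OF lam] sign_band_def abs_le_iff field_simps)
qed

end

section \<open>Interpolation series away from their poles\<close>

lemma node_ball:
  assumes "z \<notin> range (\<lambda>n. complex_of_real (node k n))"
  obtains d where "d > 0" "\<And>n w. w \<in> ball z d \<Longrightarrow> d \<le> norm (w - of_real (node k n))"
proof -
  have "z - of_real (of_int k / 2) \<notin> \<int>"
  proof
    assume "z - of_real (of_int k / 2) \<in> \<int>"
    then obtain n where "z - of_real (of_int k / 2) = of_int n" by (rule Ints_cases)
    hence "z = of_real (node k n)" by (simp add: node_def algebra_simps)
    thus False using assms by auto
  qed
  moreover have "open (- (\<int> :: complex set))"
    by (simp add: open_Compl closed_Ints)
  ultimately obtain e where e: "e > 0" "ball (z - of_real (of_int k / 2)) e \<subseteq> - \<int>"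
    unfolding open_contains_ball by blast
  show ?thesis
  proof (rule that[of "e / 2"])
    fix n w assume w: "w \<in> ball z (e / 2)"
    have "complex_of_int n \<notin> ball (z - of_real (of_int k / 2)) e"
      using e(2) by auto
    hence "e \<le> dist z (of_real (node k n))"
      by (simp add: dist_norm node_def algebra_simps)
    also have "\<dots> \<le> dist z w + dist w (of_real (node k n))"
      by (rule dist_triangle)
    finally show "e / 2 \<le> norm (w - of_real (node k n))"
      using w by (simp add: dist_norm)
  qed (use e in auto)
qed

text \<open>
  Continuity off the nodes ensures that removing the singularities does not change the values
  there. The nodes themselves form a null set on the real line.
\<close>

lemma isCont_pole_series:
  assumes c: "(\<lambda>n. norm (c n)) summable_on UNIV"
    and z: "z \<notin> range (\<lambda>n. complex_of_real (node k n))"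
  shows "isCont (\<lambda>w. \<Sum>\<^sub>\<infinity>n. c n / (w - of_real (node k n)) ^ j) z"
proof -
  obtain d where d: "d > 0" "\<And>n w. w \<in> ball z d \<Longrightarrow> d \<le> norm (w - of_real (node k n))"
    using node_ball[OF z] by metis
  have "uniform_limit (ball z d) (\<lambda>X w. \<Sum>n\<in>X. c n / (w - of_real (node k n)) ^ j)
          (\<lambda>w. \<Sum>\<^sub>\<infinity>n. c n / (w - of_real (node k n)) ^ j) (finite_subsets_at_top UNIV)"
  proof (rule Weierstrass_m_test_general)
    show "(\<lambda>n. norm (c n) * inverse (d ^ j)) summable_on UNIV"
      using c by (rule summable_on_cmult_left)
    show "norm (c n / (w - of_real (node k n)) ^ j) \<le> norm (c n) * inverse (d ^ j)"
      if "w \<in> ball z d" for n w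
      unfolding divide_inverse norm_mult norm_inverse norm_power
      using d(1) d(2)[OF that, of n] by (intro mult_left_mono le_imp_inverse_le power_mono) auto
  qed
  moreover have "continuous_on (ball z d) (\<lambda>w. \<Sum>n\<in>X. c n / (w - of_real (node k n)) ^ j)" for X
    using d by (intro continuous_intros) (metis norm_zero not_le power_not_zero)
  ultimately have "continuous_on (ball z d) (\<lambda>w. \<Sum>\<^sub>\<infinity>n. c n / (w - of_real (node k n)) ^ j)"
    by (intro uniform_limit_theorem[rotated]) (auto intro!: always_eventually)
  thus ?thesis
    using d(1) by (simp add: continuous_on_eq_continuous_at)
qed

lemma remove_sings_isCont: "isCont f z \<Longrightarrow> remove_sings f z = f z"
  by (intro remove_sings_eqI) (simp add: isCont_def)

lemma fourier_transform_cong_off_nodes: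
  assumes "\<And>x. x \<notin> range (node k) \<Longrightarrow> f x = g x"
  shows "fourier_transform f t = (LINT x|lborel. g x * cis (- (2 * pi * (x * t))))"
  unfolding fourier_transform_def
proof (rule integral_discrete_difference[where X = "range (node k)"])
  show "f x * e_fun (of_real (- (x * t))) = g x * cis (- (2 * pi * (x * t)))"
    if "x \<notin> range (node k)" for x
    unfolding e_fun_of_real assms[OF that] by simp
qed auto

text \<open>
  The exponents \<open>1\<close> bring all the series below into the form \<open>c n / (z - a n) ^ j\<close>.
\<close>

definition lagrange_series :: "real \<Rightarrow> complex \<Rightarrow> complex" where
  "lagrange_series lam z = cos (of_real pi * z) / of_real pi *
     (\<Sum>\<^sub>\<infinity>n. ((-1) powi (n + 1) * value_coeff lam 1 n) / (z - of_real (node 1 n)) ^ 1)"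

text \<open>
  For \<open>k = 1\<close> the sine is, up to sign, \<open>cos (\<pi> z)\<close>, and for \<open>k = 0\<close> it is \<open>sin (\<pi> z)\<close>.
\<close>

definition hermite_series :: "real \<Rightarrow> int \<Rightarrow> complex \<Rightarrow> complex" where
  "hermite_series lam k z = (sin (of_real pi * (z - of_int k / 2)) / of_real pi)\<^sup>2 *
     ((\<Sum>\<^sub>\<infinity>n. value_coeff lam k n / (z - of_real (node k n)) ^ 2) +
      (\<Sum>\<^sub>\<infinity>n. slope_coeff lam k n / (z - of_real (node k n)) ^ 1))"

lemma K_fun_eq: "K_fun lam = remove_sings (lagrange_series lam)"
  unfolding K_fun_def lagrange_series_def[abs_def] gaussian_node[symmetric]
  by (simp add: node_def diff_diff_eq)

lemma L_fun_eq: "L_fun lam = remove_sings (hermite_series lam 1)"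
proof -
  have "(sin (of_real pi * (z - of_int 1 / 2)) / of_real pi)\<^sup>2 = (cos (of_real pi * z) / of_real pi)\<^sup>2"
    for z :: complex
  proof -
    have "sin (of_real pi * (z - of_int 1 / 2)) = - cos (of_real pi * z)"
      using sin_diff[of "of_real pi * z" "of_real pi / 2"] sin_of_real[of "pi/2"] cos_of_real[of "pi / 2"]
      by (simp add: right_diff_distrib)
    thus ?thesis by simp
  qed
  thus ?thesis
    unfolding L_fun_def hermite_series_def[abs_def] gaussian_node[symmetric] deriv_gaussian_node[symmetric]
    by (simp add: node_def diff_diff_eq)
qed

lemma M_fun_eq: "M_fun lam = remove_sings (hermite_series lam 0)"
  unfolding M_fun_def hermite_series_def[abs_def] gaussian_node[symmetric] deriv_gaussian_node[symmetric]
  by (simp add: node_def)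

context
  fixes lam x :: real and k :: int
  assumes lam: "lam > 0" and x: "x \<notin> range (node k)"
begin

lemma complex_off_nodes: "complex_of_real x \<notin> range (\<lambda>n. of_real (node k n))"
  using x by auto

text \<open>
  The sign \<open>(- 1) powi (n + 1)\<close> turns \<open>cos (\<pi> x)\<close> into \<open>sin (\<pi> (x - a n))\<close>, so each term is a translate
  of the kernel \<open>sin (\<pi> u) / (\<pi> u)\<close>.
\<close>

lemma lagrange_series_off_nodes:
  assumes k: "k = 1"
  shows "remove_sings (lagrange_series lam) (of_real x) =
           (\<Sum>\<^sub>\<infinity>n. value_coeff lam k n * band_kernel sinc_band (x - node k n))"
proof -
  have "(\<lambda>n. norm ((-1) powi (n + 1) * value_coeff lam 1 n)) summable_on UNIV"
    using value_coeff_abs_summable[OF lam, of 1] by (simp add: norm_mult norm_power_int)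
  from isCont_pole_series[OF this complex_off_nodes[unfolded k], where j = 1]
  have "isCont (lagrange_series lam) (of_real x)"
    unfolding lagrange_series_def[abs_def] by (intro continuous_intros) auto
  hence "remove_sings (lagrange_series lam) (of_real x) = lagrange_series lam (of_real x)"
    by (rule remove_sings_isCont)
  also have "\<dots> = (\<Sum>\<^sub>\<infinity>n. cos (of_real pi * of_real x) / of_real pi *
     (((-1) powi (n + 1) * value_coeff lam 1 n) / (of_real x - of_real (node 1 n)) ^ 1))"
    unfolding lagrange_series_def by (rule infsum_cmult_right'[symmetric])
  also have "\<dots> = (\<Sum>\<^sub>\<infinity>n. value_coeff lam k n * band_kernel sinc_band (x - node k n))"
  proof (rule infsum_cong)
    fix n
    have cos_x: "cos (of_real pi * of_real x) = complex_of_real (cos (pi * x))"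
      by (simp flip: cos_of_real)
    have nz: "x - node 1 n \<noteq> 0" using x k by auto
    have "pi * (x - node 1 n) + pi * real_of_int n = pi * x - pi / 2"
      by (simp add: node_def field_simps)
    with sin_add_pi_int[of "pi * (x - node 1 n)" n]
    have "sin (pi * (x - node 1 n)) = (if even n then - cos (pi * x) else cos (pi * x))"
      by (auto simp: sin_diff split: if_splits)
    also have "\<dots> = (-1) powi (n + 1) * cos (pi * x)"
      by (simp add: power_int_minus_one_minus power_int_add power_int_minus_left)
    finally have sin_eq: "sin (pi * (x - node 1 n)) = (-1) powi (n + 1) * cos (pi * x)" .
    have "of_real (x - node 1 n) * band_kernel sinc_band (x - node 1 n) =
            of_real ((-1) powi (n + 1) * cos (pi * x) / pi)"
      unfolding sinc_band_kernel sin_eq ..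
    hence "band_kernel sinc_band (x - node 1 n) =
            of_real ((-1) powi (n + 1) * cos (pi * x) / pi) / of_real (x - node 1 n)"
      using nz by (simp add: nonzero_eq_divide_eq mult_ac del: of_real_diff)
    thus "cos (of_real pi * of_real x) / of_real pi *
            (((-1) powi (n + 1) * value_coeff lam 1 n) / (of_real x - of_real (node 1 n)) ^ 1) =
          value_coeff lam k n * band_kernel sinc_band (x - node k n)"
      by (simp add: k cos_x mult_ac)
  qed
  finally show ?thesis .
qed

text \<open>
  The square of \<open>sin (\<pi> (x - a n))\<close> does not depend on \<open>n\<close>, so the common factor can be moved into the
  terms, where it completes the poles to translates of the two kernels \<open>(sin (\<pi> u) / \<pi>)\<^sup>2 / u\<^sup>2\<close> and
  \<open>(sin (\<pi> u) / \<pi>)\<^sup>2 / u\<close>.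
\<close>

lemma hermite_series_off_nodes:
  "remove_sings (hermite_series lam k) (of_real x) =
     (\<Sum>\<^sub>\<infinity>n. value_coeff lam k n * band_kernel fejer_band (x - node k n)) +
     (\<Sum>\<^sub>\<infinity>n. slope_coeff lam k n * band_kernel sign_band (x - node k n))"
proof -
  define S where "S = complex_of_real ((sin (pi * (x - of_int k / 2)) / pi)\<^sup>2)"
  have "isCont (hermite_series lam k) (of_real x)"
    unfolding hermite_series_def[abs_def]
    by (intro continuous_intros isCont_pole_series complex_off_nodes
              value_coeff_abs_summable slope_coeff_abs_summable lam) auto
  hence "remove_sings (hermite_series lam k) (of_real x) = hermite_series lam k (of_real x)"
    by (rule remove_sings_isCont)
  also have "\<dots> = S * ((\<Sum>\<^sub>\<infinity>n. value_coeff lam k n / (of_real x - of_real (node k n)) ^ 2) +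
      (\<Sum>\<^sub>\<infinity>n. slope_coeff lam k n / (of_real x - of_real (node k n)) ^ 1))"
  proof -
    have "sin (of_real pi * (of_real x - of_int k / 2)) = complex_of_real (sin (pi * (x - of_int k / 2)))"
      by (simp flip: sin_of_real)
    thus ?thesis by (simp add: hermite_series_def S_def)
  qed
  also have "\<dots> = (\<Sum>\<^sub>\<infinity>n. S * (value_coeff lam k n / (of_real x - of_real (node k n)) ^ 2)) +
      (\<Sum>\<^sub>\<infinity>n. S * (slope_coeff lam k n / (of_real x - of_real (node k n)) ^ 1))"
    by (simp only: infsum_cmult_right' distrib_left)
  also have "(\<Sum>\<^sub>\<infinity>n. S * (value_coeff lam k n / (of_real x - of_real (node k n)) ^ 2)) =
      (\<Sum>\<^sub>\<infinity>n. value_coeff lam k n * band_kernel fejer_band (x - node k n))"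
  proof (rule infsum_cong)
    fix n
    have "x - node k n \<noteq> 0" using x by auto
    moreover have "of_real ((x - node k n)\<^sup>2) * band_kernel fejer_band (x - node k n) = S"
      unfolding fejer_band_kernel S_def power_divide sin_squared_node ..
    ultimately have "band_kernel fejer_band (x - node k n) = S / of_real ((x - node k n)\<^sup>2)"
      by (simp add: nonzero_eq_divide_eq mult.commute del: of_real_diff of_real_power)
    thus "S * (value_coeff lam k n / (of_real x - of_real (node k n)) ^ 2) =
            value_coeff lam k n * band_kernel fejer_band (x - node k n)"
      by simp
  qed
  also have "(\<Sum>\<^sub>\<infinity>n. S * (slope_coeff lam k n / (of_real x - of_real (node k n)) ^ 1)) =
      (\<Sum>\<^sub>\<infinity>n. slope_coeff lam k n * band_kernel sign_band (x - node k n))"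
  proof (rule infsum_cong)
    fix n
    have "x - node k n \<noteq> 0" using x by auto
    moreover have "of_real (x - node k n) * band_kernel sign_band (x - node k n) = S"
      unfolding sign_band_kernel S_def power_divide sin_squared_node ..
    ultimately have "band_kernel sign_band (x - node k n) = S / of_real (x - node k n)"
      by (simp add: nonzero_eq_divide_eq mult.commute del: of_real_diff)
    thus "S * (slope_coeff lam k n / (of_real x - of_real (node k n)) ^ 1) =
            slope_coeff lam k n * band_kernel sign_band (x - node k n)"
      by simp
  qed
  finally show ?thesis .
qed

end

section \<open>The Fourier transforms of the interpolating functions\<close>

lemma fourier_transform_lagrange:
  assumes lam: "lam > 0" and t: "\<bar>t\<bar> \<le> 1 / 2"
  shows "fourier_transform (\<lambda>x. remove_sings (lagrange_series lam) (of_real x)) t =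
           node_theta lam 1 (of_real t)"
  using fourier_transform_cong_off_nodes[OF lagrange_series_off_nodes[OF lam _ refl], where t = t]
        fourier_value_sinc[OF lam _ t, of 1]
  by simp

lemma fourier_transform_hermite:
  assumes lam: "lam > 0" and t: "\<bar>t\<bar> \<le> 1"
  shows "fourier_transform (\<lambda>x. remove_sings (hermite_series lam k) (of_real x)) t =
           of_real (1 - \<bar>t\<bar>) * node_theta lam k (of_real t)
           - of_real (inverse (2 * pi) * lam * sgn t) * deriv (node_theta lam k) (of_real t)"
proof -
  let ?F = "\<lambda>x. \<Sum>\<^sub>\<infinity>n. value_coeff lam k n * band_kernel fejer_band (x - node k n)"
  let ?G = "\<lambda>x. \<Sum>\<^sub>\<infinity>n. slope_coeff lam k n * band_kernel sign_band (x - node k n)"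
  have int: "integrable lborel (\<lambda>x. f x * cis (- (2 * pi * (x * t))))"
    if "integrable lborel f" for f :: "real \<Rightarrow> complex"
  proof (rule Bochner_Integration.integrable_bound[OF that])
    have [measurable]: "f \<in> borel_measurable lborel" using that by auto
    show "(\<lambda>x. f x * cis (- (2 * pi * (x * t)))) \<in> borel_measurable lborel"
      by measurable
  qed (simp add: norm_mult)
  have "fourier_transform (\<lambda>x. remove_sings (hermite_series lam k) (of_real x)) t =
          (LINT x|lborel. (?F x + ?G x) * cis (- (2 * pi * (x * t))))"
    by (rule fourier_transform_cong_off_nodes[OF hermite_series_off_nodes[OF lam]])
  also have "\<dots> = (LINT x|lborel. ?F x * cis (- (2 * pi * (x * t)))) +
                   (LINT x|lborel. ?G x * cis (- (2 * pi * (x * t))))"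
    unfolding distrib_right
    by (intro Bochner_Integration.integral_add int integrable_value_fejer integrable_slope_sign lam)
  also have "\<dots> = of_real (1 - \<bar>t\<bar>) * node_theta lam k (of_real t)
           - of_real (inverse (2 * pi) * lam * sgn t) * deriv (node_theta lam k) (of_real t)"
    unfolding fourier_value_fejer[OF lam t] fourier_slope_sign[OF lam t] by simp
  finally show ?thesis .
qed

theorem theorem4:
  fixes lam :: real
  assumes "lam > 0"
  shows "(\<forall>t::real. - (1/2) \<le> t \<and> t \<le> 1/2 \<longrightarrow>
           fourier_transform (\<lambda>x. K_fun lam (of_real x)) t = theta1 (of_real t) (\<i> * of_real lam))
     \<and> (\<forall>t::real. -1 \<le> t \<and> t \<le> 1 \<longrightarrow>
           fourier_transform (\<lambda>x. L_fun lam (of_real x)) t =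
             of_real (1 - \<bar>t\<bar>) * theta1 (of_real t) (\<i> * of_real lam)
             - of_real (inverse (2 * pi) * lam * sgn t)
               * deriv (\<lambda>v. theta1 v (\<i> * of_real lam)) (of_real t)
         \<and> fourier_transform (\<lambda>x. M_fun lam (of_real x)) t =
             of_real (1 - \<bar>t\<bar>) * theta3 (of_real t) (\<i> * of_real lam)
             - of_real (inverse (2 * pi) * lam * sgn t)
               * deriv (\<lambda>v. theta3 v (\<i> * of_real lam)) (of_real t))"
proof (intro conjI allI impI)
  fix t :: real
  assume "- (1/2) \<le> t \<and> t \<le> 1/2"
  hence "\<bar>t\<bar> \<le> 1 / 2" by auto
  from fourier_transform_lagrange[OF assms this]
  show "fourier_transform (\<lambda>x. K_fun lam (of_real x)) t = theta1 (of_real t) (\<i> * of_real lam)"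
    by (simp only: K_fun_eq theta1_eq)
next
  fix t :: real
  assume "-1 \<le> t \<and> t \<le> 1"
  hence t: "\<bar>t\<bar> \<le> 1" by auto
  show "fourier_transform (\<lambda>x. L_fun lam (of_real x)) t =
             of_real (1 - \<bar>t\<bar>) * theta1 (of_real t) (\<i> * of_real lam)
             - of_real (inverse (2 * pi) * lam * sgn t)
               * deriv (\<lambda>v. theta1 v (\<i> * of_real lam)) (of_real t)"
    unfolding L_fun_eq theta1_eq by (rule fourier_transform_hermite[OF assms t])
  show "fourier_transform (\<lambda>x. M_fun lam (of_real x)) t =
             of_real (1 - \<bar>t\<bar>) * theta3 (of_real t) (\<i> * of_real lam)
             - of_real (inverse (2 * pi) * lam * sgn t)
               * deriv (\<lambda>v. theta3 v (\<i> * of_real lam)) (of_real t)"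
    unfolding M_fun_eq theta3_eq by (rule fourier_transform_hermite[OF assms t])
qed

end
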